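(* Let $k\ge 2$ and let $G = H\rtimes F_k$, where $F_k$ is the free group of rank $k$ and $H$ is a finitely generated group that does not algebraically fiber. If $G$ has excessive homology, i.e. $\operatorname{rk} H^1(G;\mathbb{R})\ge k+1$, then $G$ is incoherent.
   Context: A group is coherent if every finitely generated subgroup is finitely presented, and incoherent otherwise (i.e. if it has a finitely generated subgroup that is not finitely presented). A group $A$ algebraically fibers if there is a surjective homomorphism $A\to\mathbb{Z}$ with finitely generated kernel. A group $G=H\rtimes F_k$ has excessive homology if $\operatorname{rk} H^1(G;\mathbb{R})\geq k+1$, where $\operatorname{rk}$ denotes dimension over $\mathbb{R}$. *)

theory Defs
  imports
    "HOL-Algebra.Bij"
    "HOL-Algebra.Elementary_Groups"
    "HOL-Algebra.Generated_Groups"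
    "Jordan_Normal_Form.VS_Connect"
begin

section \<open>Free groups\<close>

text \<open>A letter \<open>(x, True)\<close> stands for the generator \<open>x\<close>, and \<open>(x, False)\<close> for its inverse.
  The elements of the free group are the reduced words.\<close>

definition inv_letter :: "'x \<times> bool \<Rightarrow> 'x \<times> bool" where
  "inv_letter l = (fst l, \<not> snd l)"

definition reduced :: "('x \<times> bool) list \<Rightarrow> bool" where
  "reduced w \<longleftrightarrow> successively (\<lambda>l m. m \<noteq> inv_letter l) w"

fun cancel_cons :: "'x \<times> bool \<Rightarrow> ('x \<times> bool) list \<Rightarrow> ('x \<times> bool) list" where
  "cancel_cons l [] = [l]"
| "cancel_cons l (m # w) = (if m = inv_letter l then w else l # m # w)"

definition reduce :: "('x \<times> bool) list \<Rightarrow> ('x \<times> bool) list" where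
  "reduce w = foldr cancel_cons w []"

definition free_group :: "'x set \<Rightarrow> ('x \<times> bool) list monoid" where
  "free_group X =
    \<lparr>carrier = {w. set w \<subseteq> X \<times> UNIV \<and> reduced w},
     monoid.mult = (\<lambda>u v. reduce (u @ v)),
     one = []\<rparr>"

lemma inv_letter_inv_letter [simp]: "inv_letter (inv_letter l) = l"
  by (simp add: inv_letter_def)

lemma inv_letter_neq [simp]: "inv_letter l \<noteq> l" "l \<noteq> inv_letter l"
  by (auto simp: inv_letter_def prod_eq_iff)

lemma reduced_cancel_cons: "reduced w \<Longrightarrow> reduced (cancel_cons l w)"
  by (cases w) (auto simp: reduced_def successively_Cons)

lemma cancel_cons_inv: "reduced w \<Longrightarrow> cancel_cons l (cancel_cons (inv_letter l) w) = w"
  by (cases w rule: remdups_adj.cases) (auto simp: reduced_def)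

lemma reduced_foldr: "reduced w \<Longrightarrow> reduced (foldr cancel_cons u w)"
  by (induction u) (auto intro: reduced_cancel_cons)

lemma reduced_reduce: "reduced (reduce w)"
  unfolding reduce_def by (rule reduced_foldr) (simp add: reduced_def)

lemma reduce_reduced: "reduced w \<Longrightarrow> reduce w = w"
proof (induction w)
  case (Cons l w)
  then show ?case
    by (cases w) (auto simp: reduce_def reduced_def)
qed (simp add: reduce_def)

lemma foldr_cancel_cons:
  "reduced w \<Longrightarrow> foldr cancel_cons (cancel_cons l u) w = cancel_cons l (foldr cancel_cons u w)"
  by (cases u) (auto simp: cancel_cons_inv reduced_foldr)

lemma foldr_reduce: "reduced w \<Longrightarrow> foldr cancel_cons (reduce u) w = foldr cancel_cons u w"
  by (induction u) (auto simp: reduce_def foldr_cancel_cons)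

lemma set_reduce: "set (reduce w) \<subseteq> set w"
proof -
  have "set (cancel_cons l v) \<subseteq> insert l (set v)" for l and v :: "('a \<times> bool) list"
    by (cases v) auto
  then show ?thesis
    by (induction w) (force simp: reduce_def)+
qed

lemma reduce_append: "reduce (u @ v) = foldr cancel_cons u (reduce v)"
  by (simp add: reduce_def)

lemma reduce_append_reduce:
  "reduce (reduce u @ v) = reduce (u @ v)" "reduce (u @ reduce v) = reduce (u @ v)"
  by (simp_all add: reduce_append foldr_reduce reduced_reduce reduce_reduced)

lemma reduce_inverse: "reduce (rev (map inv_letter w) @ w) = []"
proof (induction w)
  case (Cons l w)
  have "reduce (rev (map inv_letter w) @ cancel_cons (inv_letter l) (cancel_cons l (reduce w)))
      = reduce (rev (map inv_letter w) @ w)"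
    using cancel_cons_inv[OF reduced_reduce, of "inv_letter l" w]
    by (simp add: reduce_append_reduce)
  moreover have "reduce (rev (map inv_letter (l # w)) @ l # w)
      = reduce (rev (map inv_letter w) @ cancel_cons (inv_letter l) (cancel_cons l (reduce w)))"
    using cancel_cons_inv[OF reduced_reduce, of "inv_letter l" w]
    by (simp add: reduce_append reduce_reduced reduced_reduce) (simp add: reduce_def)
  ultimately show ?case
    using Cons by simp
qed (simp add: reduce_def)

lemma group_free_group: "group (free_group X)"
proof (rule groupI)
  fix u assume u: "u \<in> carrier (free_group X)"
  let ?v = "reduce (rev (map inv_letter u))"
  have "set (rev (map inv_letter u)) \<subseteq> X \<times> UNIV"
    using u by (auto simp: free_group_def inv_letter_def)
  then have "?v \<in> carrier (free_group X)"
    using set_reduce[of "rev (map inv_letter u)"] by (auto simp: free_group_def reduced_reduce)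
  moreover have "?v \<otimes>\<^bsub>free_group X\<^esub> u = \<one>\<^bsub>free_group X\<^esub>"
    by (simp add: free_group_def reduce_append_reduce reduce_inverse)
  ultimately show "\<exists>v \<in> carrier (free_group X). v \<otimes>\<^bsub>free_group X\<^esub> u = \<one>\<^bsub>free_group X\<^esub>"
    by blast
next
  fix u v assume "u \<in> carrier (free_group X)" "v \<in> carrier (free_group X)"
  then show "u \<otimes>\<^bsub>free_group X\<^esub> v \<in> carrier (free_group X)"
    using set_reduce[of "u @ v"] by (auto simp: free_group_def reduced_reduce)
qed (auto simp: free_group_def reduce_append_reduce reduce_reduced reduced_def[of "[]"])

section \<open>Finiteness properties\<close>

definition finitely_generated :: "('a, 'm) monoid_scheme \<Rightarrow> bool" where
  "finitely_generated G \<longleftrightarrow> (\<exists>S. finite S \<and> S \<subseteq> carrier G \<and> generate G S = carrier G)"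

definition normal_closure :: "('a, 'm) monoid_scheme \<Rightarrow> 'a set \<Rightarrow> 'a set" where
  "normal_closure G R = \<Inter>{N. normal N G \<and> R \<subseteq> N}"

definition finitely_presented :: "('a, 'm) monoid_scheme \<Rightarrow> bool" where
  "finitely_presented G \<longleftrightarrow>
    (\<exists>(n::nat) R. finite R \<and> R \<subseteq> carrier (free_group {..<n}) \<and>
      G \<cong> free_group {..<n} Mod normal_closure (free_group {..<n}) R)"

definition coherent :: "('a, 'm) monoid_scheme \<Rightarrow> bool" where
  "coherent G \<longleftrightarrow>
    (\<forall>K. subgroup K G \<longrightarrow> finitely_generated (G\<lparr>carrier := K\<rparr>) \<longrightarrow>
      finitely_presented (G\<lparr>carrier := K\<rparr>))"

abbreviation incoherent :: "('a, 'm) monoid_scheme \<Rightarrow> bool" where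
  "incoherent G \<equiv> \<not> coherent G"

definition algebraically_fibers :: "('a, 'm) monoid_scheme \<Rightarrow> bool" where
  "algebraically_fibers A \<longleftrightarrow>
    (\<exists>\<phi> \<in> epi A integer_group.
      finitely_generated (A\<lparr>carrier := kernel A integer_group \<phi>\<rparr>))"

section \<open>Semidirect products\<close>

definition semidirect_product ::
  "('a, 'm) monoid_scheme \<Rightarrow> ('b, 'n) monoid_scheme \<Rightarrow> ('b \<Rightarrow> 'a \<Rightarrow> 'a) \<Rightarrow> ('a \<times> 'b) monoid"
  where
  "semidirect_product H K \<alpha> =
    \<lparr>carrier = carrier H \<times> carrier K,
     monoid.mult = (\<lambda>(h, x) (h', x'). (h \<otimes>\<^bsub>H\<^esub> \<alpha> x h', x \<otimes>\<^bsub>K\<^esub> x')),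
     one = (\<one>\<^bsub>H\<^esub>, \<one>\<^bsub>K\<^esub>)\<rparr>"

lemma group_semidirect_product:
  assumes "group H" "group K" "\<alpha> \<in> hom K (AutoGroup H)"
  shows "group (semidirect_product H K \<alpha>)"
proof -
  interpret H: group H by fact
  interpret K: group K by fact
  interpret A: group "AutoGroup H" by (rule H.AutoGroup)
  interpret \<alpha>: group_hom K "AutoGroup H" \<alpha>
    using assms(3) by unfold_locales
  have aut: "\<alpha> x \<in> hom H H" "\<alpha> x \<in> Bij (carrier H)" if "x \<in> carrier K" for x
    using \<alpha>.hom_closed[OF that] by (auto simp: AutoGroup_def auto_def)
  have closed: "\<alpha> x h \<in> carrier H" if "x \<in> carrier K" "h \<in> carrier H" for x h
    using aut(1)[OF that(1)] that(2) by (auto simp: hom_def)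
  have mult: "\<alpha> x (h \<otimes>\<^bsub>H\<^esub> h') = \<alpha> x h \<otimes>\<^bsub>H\<^esub> \<alpha> x h'"
    if "x \<in> carrier K" "h \<in> carrier H" "h' \<in> carrier H" for x h h'
    using aut(1)[OF that(1)] that(2,3) by (rule hom_mult)
  have comp: "\<alpha> (x \<otimes>\<^bsub>K\<^esub> y) h = \<alpha> x (\<alpha> y h)"
    if "x \<in> carrier K" "y \<in> carrier K" "h \<in> carrier H" for x y h
    using \<alpha>.hom_mult[OF that(1,2)] aut(2)[OF that(1)] aut(2)[OF that(2)] that(3)
    by (simp add: AutoGroup_def BijGroup_def compose_def)
  have one: "\<alpha> \<one>\<^bsub>K\<^esub> h = h" if "h \<in> carrier H" for h
    using \<alpha>.hom_one that by (simp add: AutoGroup_def BijGroup_def)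
  show ?thesis
  proof (rule groupI)
    fix p assume "p \<in> carrier (semidirect_product H K \<alpha>)"
    then obtain h x where p: "p = (h, x)" "h \<in> carrier H" "x \<in> carrier K"
      by (auto simp: semidirect_product_def)
    let ?q = "(\<alpha> (inv\<^bsub>K\<^esub> x) (inv\<^bsub>H\<^esub> h), inv\<^bsub>K\<^esub> x)"
    have "\<alpha> (inv\<^bsub>K\<^esub> x) (inv\<^bsub>H\<^esub> h) \<otimes>\<^bsub>H\<^esub> \<alpha> (inv\<^bsub>K\<^esub> x) h = \<alpha> (inv\<^bsub>K\<^esub> x) \<one>\<^bsub>H\<^esub>"
      using p mult[of "inv\<^bsub>K\<^esub> x" "inv\<^bsub>H\<^esub> h" h] by simp
    moreover have "\<alpha> (inv\<^bsub>K\<^esub> x) \<one>\<^bsub>H\<^esub> = \<one>\<^bsub>H\<^esub>"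
      using hom_one[OF aut(1)[of "inv\<^bsub>K\<^esub> x"]] p H.group_axioms K.inv_closed by blast
    ultimately have "?q \<otimes>\<^bsub>semidirect_product H K \<alpha>\<^esub> p = \<one>\<^bsub>semidirect_product H K \<alpha>\<^esub>"
      using p by (simp add: semidirect_product_def)
    moreover have "?q \<in> carrier (semidirect_product H K \<alpha>)"
      using p closed by (simp add: semidirect_product_def del: \<alpha>.hom_inv)
    ultimately show "\<exists>q \<in> carrier (semidirect_product H K \<alpha>).
        q \<otimes>\<^bsub>semidirect_product H K \<alpha>\<^esub> p = \<one>\<^bsub>semidirect_product H K \<alpha>\<^esub>"
      by blast
  qed (auto simp: semidirect_product_def closed mult comp one H.m_assoc K.m_assoc
      simp del: \<alpha>.hom_mult \<alpha>.hom_one)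
qed

section \<open>First cohomology with trivial real coefficients\<close>

text \<open>We use inhomogeneous cochains. A cochain is a function on the carrier, encoded as a
  function that vanishes outside the carrier. Since \<open>G\<close> acts trivially on the coefficients,
  the differentials \<open>g\<cdot>c - c\<close> and \<open>g\<cdot>f(h) - f(gh) + f(g)\<close> lose the action of \<open>g\<close>; in
  particular every 1-coboundary is zero.\<close>

definition cocycles1 :: "('a, 'm) monoid_scheme \<Rightarrow> ('a \<Rightarrow> real) set" where
  "cocycles1 G =
    {f. (\<forall>g. g \<notin> carrier G \<longrightarrow> f g = 0) \<and>
        (\<forall>g \<in> carrier G. \<forall>h \<in> carrier G. f h - f (g \<otimes>\<^bsub>G\<^esub> h) + f g = 0)}"

definition coboundaries1 :: "('a, 'm) monoid_scheme \<Rightarrow> ('a \<Rightarrow> real) set" where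
  "coboundaries1 G = {\<lambda>g. if g \<in> carrier G then c - c else 0 | c. True}"

definition cohomology_class1 :: "('a, 'm) monoid_scheme \<Rightarrow> ('a \<Rightarrow> real) \<Rightarrow> ('a \<Rightarrow> real) set" where
  "cohomology_class1 G f = {\<lambda>g. f g + b g | b. b \<in> coboundaries1 G}"

text \<open>The module records of HOL-Algebra extend the ring records, so a vector space also has
  (irrelevant) fields \<open>mult\<close> and \<open>one\<close>.\<close>

definition cohomology1 :: "('a, 'm) monoid_scheme \<Rightarrow> (real, ('a \<Rightarrow> real) set) module" where
  "cohomology1 G =
    \<lparr>carrier = cohomology_class1 G ` cocycles1 G,
     monoid.mult = undefined,
     one = undefined,
     zero = coboundaries1 G,
     add = (\<lambda>X Y. {\<lambda>g. x g + y g | x y. x \<in> X \<and> y \<in> Y}),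
     smult = (\<lambda>r X. {\<lambda>g. r * x g + b g | x b. x \<in> X \<and> b \<in> coboundaries1 G})\<rparr>"

lemma coboundaries1_eq: "coboundaries1 G = {\<lambda>_. 0}"
  by (simp add: coboundaries1_def cong: if_cong)

lemma vectorspace_cohomology1: "vectorspace class_ring (cohomology1 G)"
proof -
  have [simp]: "cohomology_class1 G f = {f}" for f
    by (simp add: cohomology_class1_def coboundaries1_eq)
  have add: "\<exists>y \<in> cocycles1 G. (\<lambda>g. y g + x g) = (\<lambda>_. 0)" if "x \<in> cocycles1 G" for x
    using that by (intro bexI[of _ "\<lambda>g. - x g"]) (force simp: cocycles1_def algebra_simps)+
  have "abelian_group (cohomology1 G)"
  proof (rule abelian_groupI)
    fix X assume "X \<in> carrier (cohomology1 G)"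
    then obtain x where X: "X = {x}" and x: "x \<in> cocycles1 G"
      by (auto simp: cohomology1_def)
    from add[OF x] obtain y where "y \<in> cocycles1 G" "(\<lambda>g. y g + x g) = (\<lambda>_. 0)"
      by blast
    then show "\<exists>Y \<in> carrier (cohomology1 G). Y \<oplus>\<^bsub>cohomology1 G\<^esub> X = \<zero>\<^bsub>cohomology1 G\<^esub>"
      by (intro bexI[of _ "{y}"]) (auto simp: X cohomology1_def coboundaries1_eq)
  qed (auto simp: cohomology1_def coboundaries1_eq cocycles1_def algebra_simps)
  moreover have "field (class_ring :: real ring)"
    by (rule class_field.field_axioms)
  moreover have "module_axioms (class_ring :: real ring) (cohomology1 G)"
    by unfold_locales
      (auto simp: cohomology1_def coboundaries1_eq cocycles1_def algebra_simps
         simp flip: distrib_left,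
       simp add: fun_eq_iff algebra_simps)
  ultimately show ?thesis
    by (intro vectorspace.intro Module.module.intro class_cring.cring_axioms)
qed

text \<open>The library's \<open>dim\<close> is a natural number, and it means the dimension only for
  finite-dimensional spaces; an infinite-dimensional \<open>H\<^sup>1(G; \<real>)\<close> has rank at least \<open>k + 1\<close>.\<close>

definition excessive_homology :: "nat \<Rightarrow> ('a, 'm) monoid_scheme \<Rightarrow> bool" where
  "excessive_homology k G \<longleftrightarrow>
    (vectorspace.fin_dim class_ring (cohomology1 G) \<longrightarrow>
      k + 1 \<le> vectorspace.dim class_ring (cohomology1 G))"

end

theory Submission
  imports Defs
begin

text \<open>
  Let \<open>F\<close> be the free group of rank \<open>k\<close> and \<open>p : G \<rightarrow> F\<close> the projection with kernel \<open>H\<close>. The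
  subgroup of \<open>G\<close> that witnesses incoherence is the kernel \<open>K\<close> of a suitable homomorphism
  \<open>G \<rightarrow> \<int>\<close>.

  \<^item> Since \<open>H\<^sup>1(F; \<real>)\<close> has dimension \<open>k\<close>, excessive homology gives a homomorphism \<open>G \<rightarrow> \<real>\<close> that does
    not vanish on \<open>H\<close>. Because \<open>H\<close> is finitely generated, composing with an additive map
    turns its restriction to \<open>H\<close> into a surjection \<open>\<chi> : H \<rightarrow> \<int>\<close> that is still invariant under
    conjugation by \<open>G\<close>; so \<open>\<chi>\<close> extends to \<open>G\<close>. As \<open>H\<close> does not algebraically fiber,
    \<open>N = {g \<in> H. \<chi> g = 0}\<close> is not finitely generated.

  \<^item> Let \<open>x\<close> lift a free generator with \<open>\<chi> x = 0\<close>, and let \<open>h \<in> H\<close> with \<open>\<chi> h = 1\<close>. Then \<open>N\<close> is the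
    increasing union of the subgroups that are generated by the conjugates of a fixed finite set
    by powers of \<open>h\<close> with bounded exponent. Conjugation by \<open>x\<close> changes the bound by a constant,
    whereas conjugation by \<open>h\<^sup>M\<close> shifts it by \<open>M\<close>. Hence, for large \<open>M\<close>, the element
    \<open>r = x h\<^sup>-\<^sup>M\<close> and finitely many elements of \<open>N\<close> generate a group that contains \<open>N\<close> (lemma
    \<open>kernel_in_finitely_generated_extension\<close>). This is a concrete instance of the openness of the Bieri--Neumann--Strebel invariant. Let \<open>K\<close> be the
    kernel of \<open>\<chi> + e \<circ> p\<close>, where \<open>e(p x) = M\<close> and \<open>e\<close> kills the other free generators. Then \<open>K\<close>
    is generated by that group and by suitable lifts of the other free generators.

  \<^item> The group \<open>K\<close> maps onto \<open>F\<close> with kernel \<open>N\<close>. For a second free generator \<open>y\<close>, it is an HNN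
    extension of a finitely generated group, with a stable letter \<open>t\<close> that lifts \<open>y\<close> and with \<open>N\<close>
    as associated subgroup. Such a group is not finitely presented, since a finite presentation
    would use the relations \<open>t n t\<^sup>-\<^sup>1 = n'\<close> for only finitely many \<open>n \<in> N\<close>, and these do not imply the others. The
    last claim usually rests on normal forms. Here it is read off from permutations of two
    copies of \<open>K\<close> that satisfy the relations for a prescribed finite set of \<open>n\<close> but not for
    all of \<open>N\<close> (lemma \<open>not_finitely_presented_over_free\<close>).
\<close>

section \<open>The universal property of free groups\<close>

abbreviation free_gen :: "'x \<Rightarrow> ('x \<times> bool) list" where
  "free_gen x \<equiv> [(x, True)]"

lemma one_free_group [simp]: "\<one>\<^bsub>free_group X\<^esub> = []"
  by (simp add: free_group_def)

lemma free_gen_closed [simp]: "x \<in> X \<Longrightarrow> [(x, b)] \<in> carrier (free_group X)"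
  by (simp add: free_group_def reduced_def)

lemma mult_free_group: "u \<otimes>\<^bsub>free_group X\<^esub> v = reduce (u @ v)"
  by (simp add: free_group_def)

lemma inv_free_gen:
  assumes "x \<in> X"
  shows "inv\<^bsub>free_group X\<^esub> [(x, b)] = [(x, \<not> b)]"
  using assms
  by (intro group.inv_equality[OF group_free_group])
     (simp_all add: mult_free_group reduce_def inv_letter_def)

lemma free_group_mono: "Y \<subseteq> X \<Longrightarrow> carrier (free_group Y) \<subseteq> carrier (free_group X)"
  by (auto simp: free_group_def)

text \<open>Induction along multiplication by a generator or its inverse on the left. Stripping the
  first letter of a reduced word is such a step, because the rest is again reduced.\<close>

lemma free_group_induct [consumes 1, case_names one gen inv]:
  assumes w: "w \<in> carrier (free_group X)"
    and one: "P []"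
    and gen: "\<And>x w. x \<in> X \<Longrightarrow> w \<in> carrier (free_group X) \<Longrightarrow> P w \<Longrightarrow>
      P (free_gen x \<otimes>\<^bsub>free_group X\<^esub> w)"
    and inv: "\<And>x w. x \<in> X \<Longrightarrow> w \<in> carrier (free_group X) \<Longrightarrow> P w \<Longrightarrow>
      P (inv\<^bsub>free_group X\<^esub> free_gen x \<otimes>\<^bsub>free_group X\<^esub> w)"
  shows "P w"
  using w
proof (induction w)
  case Nil
  show ?case by (rule one)
next
  case (Cons l w)
  obtain x b where l: "l = (x, b)" by fastforce
  have red: "reduced (l # w)" and x: "x \<in> X"
    using Cons.prems by (auto simp: free_group_def l)
  have w: "w \<in> carrier (free_group X)"
    using Cons.prems by (auto simp: free_group_def reduced_def successively_Cons)
  have "[l] \<otimes>\<^bsub>free_group X\<^esub> w = l # w"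
    using reduce_reduced[OF red] by (simp add: mult_free_group)
  then show ?case
    using gen[OF x w] inv[OF x w] Cons.IH[OF w] inv_free_gen[OF x, of True]
    by (cases b) (auto simp: l)
qed

lemma hom_free_group_unique:
  assumes Q: "group Q" and f: "f \<in> hom (free_group X) Q" and g: "g \<in> hom (free_group X) Q"
    and eq: "\<And>x. x \<in> X \<Longrightarrow> f (free_gen x) = g (free_gen x)"
    and w: "w \<in> carrier (free_group X)"
  shows "f w = g w"
proof -
  interpret f: group_hom "free_group X" Q f
    using Q f by (simp add: group_hom_def group_hom_axioms_def group_free_group)
  interpret g: group_hom "free_group X" Q g
    using Q g by (simp add: group_hom_def group_hom_axioms_def group_free_group)
  show ?thesis
    using w
  proof (induction w rule: free_group_induct)
    case one
    show ?case using f.hom_one g.hom_one by simp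
  qed (simp_all add: eq)
qed

definition free_lift :: "('b, 'm) monoid_scheme \<Rightarrow> ('x \<Rightarrow> 'b) \<Rightarrow> ('x \<times> bool) list \<Rightarrow> 'b" where
  "free_lift Q v w =
    foldr (\<lambda>l a. (if snd l then v (fst l) else inv\<^bsub>Q\<^esub> v (fst l)) \<otimes>\<^bsub>Q\<^esub> a) w \<one>\<^bsub>Q\<^esub>"

lemma free_lift_gen:
  assumes "group Q" "v x \<in> carrier Q"
  shows "free_lift Q v (free_gen x) = v x"
  using assms by (simp add: free_lift_def group.is_monoid)

text \<open>The product of the letter values is multiplicative on words under concatenation, and
  free reduction does not change it, because cancelling letters have inverse values.\<close>

lemma free_lift_hom:
  assumes Q: "group Q" and v: "v \<in> X \<rightarrow> carrier Q"
  shows "free_lift Q v \<in> hom (free_group X) Q"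
proof -
  interpret Q: group Q by fact
  let ?e = "free_lift Q v"
  let ?val = "\<lambda>l. if snd l then v (fst l) else inv\<^bsub>Q\<^esub> v (fst l)"
  have e_Cons: "?e (l # w) = ?val l \<otimes>\<^bsub>Q\<^esub> ?e w" for l w
    by (simp add: free_lift_def)
  have e_Nil: "?e [] = \<one>\<^bsub>Q\<^esub>"
    by (simp add: free_lift_def)
  have val: "?val l \<in> carrier Q" if "l \<in> X \<times> UNIV" for l
    using that v by auto
  have closed: "?e w \<in> carrier Q" if "set w \<subseteq> X \<times> UNIV" for w
    using that
  proof (induction w)
    case (Cons l w)
    then have "l \<in> X \<times> UNIV" "?e w \<in> carrier Q"
      by simp_all
    from Q.m_closed[OF val[OF this(1)] this(2)] show ?case
      by (simp only: e_Cons)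
  qed (simp add: e_Nil)
  have app: "?e (u @ w) = ?e u \<otimes>\<^bsub>Q\<^esub> ?e w" if "set u \<subseteq> X \<times> UNIV" "set w \<subseteq> X \<times> UNIV" for u w
    using that
  proof (induction u)
    case (Cons l u)
    then have "l \<in> X \<times> UNIV" by simp
    from val[OF this] Cons closed show ?case
      by (simp add: e_Cons Q.m_assoc del: if_split)
  qed (simp add: e_Nil closed)
  have cancel: "?e (cancel_cons l w) = ?val l \<otimes>\<^bsub>Q\<^esub> ?e w"
    if l: "l \<in> X \<times> UNIV" and w: "set w \<subseteq> X \<times> UNIV" for l w
  proof (cases w)
    case (Cons m w')
    have "?val l \<otimes>\<^bsub>Q\<^esub> (?val (inv_letter l) \<otimes>\<^bsub>Q\<^esub> ?e w') = ?e w'"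
    proof -
      have "v (fst l) \<in> carrier Q" "?e w' \<in> carrier Q"
        using l v w Cons closed by auto
      then show ?thesis
        by (auto simp: inv_letter_def Q.m_assoc[symmetric])
    qed
    then show ?thesis
      by (cases "m = inv_letter l") (simp_all only: Cons e_Cons cancel_cons.simps if_True if_False refl)
  qed (simp add: e_Cons)
  have red: "?e (reduce w) = ?e w" if "set w \<subseteq> X \<times> UNIV" for w
    using that
  proof (induction w)
    case (Cons l w)
    then have "l \<in> X \<times> UNIV" "set (reduce w) \<subseteq> X \<times> UNIV"
      using set_reduce[of w] by auto
    from cancel[OF this] Cons show ?case
      by (simp add: reduce_def e_Cons del: if_split)
  qed (simp add: reduce_def)
  show ?thesis
    by (rule homI) (auto simp: free_group_def closed red app)
qed

section \<open>Finite generation and finite presentation\<close>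

lemma (in group) mult_inv_cancel:
  assumes "x \<in> carrier G" "y \<in> carrier G"
  shows "x \<otimes> (inv x \<otimes> y) = y" "inv x \<otimes> (x \<otimes> y) = y"
  using assms by (simp_all add: m_assoc[symmetric])

lemma (in group) inv_conjugation_swap:
  assumes "a \<in> carrier G" "b \<in> carrier G" "c \<in> carrier G" and eq: "a \<otimes> b = c \<otimes> a"
  shows "inv a \<otimes> c = b \<otimes> inv a"
proof -
  have "inv a \<otimes> c = inv a \<otimes> (c \<otimes> a) \<otimes> inv a"
    using assms(1-3) by (simp add: m_assoc)
  also have "\<dots> = b \<otimes> inv a"
    using assms(1-3) by (simp add: m_assoc mult_inv_cancel flip: eq)
  finally show ?thesis .
qed



lemma finitely_generated_epi_image:
  assumes A: "group A" and B: "group B" and f: "f \<in> epi A B" and fg: "finitely_generated A"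
  shows "finitely_generated B"
proof -
  interpret f: group_hom A B f
    using A B f by (simp add: group_hom_def group_hom_axioms_def epi_def)
  obtain S where S: "finite S" "S \<subseteq> carrier A" "generate A S = carrier A"
    using fg by (auto simp: finitely_generated_def)
  have "generate B (f ` S) = carrier B"
    using f.generate_img[OF S(2)] S(3) f by (simp add: epi_def)
  then show ?thesis
    using S f.hom_closed unfolding finitely_generated_def
    by (intro exI[of _ "f ` S"]) auto
qed

lemma finitely_generated_subgroup_iff:
  assumes G: "group G" and K: "subgroup K G"
  shows "finitely_generated (G\<lparr>carrier := K\<rparr>) \<longleftrightarrow> (\<exists>S. finite S \<and> S \<subseteq> K \<and> generate G S = K)"
  using group.generate_consistent[OF G _ K]
  by (simp add: finitely_generated_def) (metis (no_types))

lemma normal_normal_closure: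
  assumes G: "group G" and R: "R \<subseteq> carrier G"
  shows "normal (normal_closure G R) G"
proof -
  interpret G: group G by fact
  have "normal (carrier G) G"
    by (rule G.normal_self)
  with R have "{N. normal N G \<and> R \<subseteq> N} \<noteq> {}"
    by blast
  then have "subgroup (normal_closure G R) G"
    unfolding normal_closure_def
    by (intro G.subgroups_Inter) (auto intro: normal_imp_subgroup)
  moreover have "x \<otimes>\<^bsub>G\<^esub> h \<otimes>\<^bsub>G\<^esub> inv\<^bsub>G\<^esub> x \<in> normal_closure G R"
    if "x \<in> carrier G" "h \<in> normal_closure G R" for x h
    using that by (auto simp: normal_closure_def intro: normal.inv_op_closed2)
  ultimately show ?thesis
    by (simp add: G.normal_inv_iff)
qed

lemma hom_eq_on_generate:
  assumes G: "group G" and Q: "group Q" and S: "S \<subseteq> carrier G"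
    and f: "f \<in> hom G Q" and g: "g \<in> hom G Q" and eq: "\<And>s. s \<in> S \<Longrightarrow> f s = g s"
    and u: "u \<in> generate G S"
  shows "f u = g u"
proof -
  interpret f: group_hom G Q f
    using assms by (simp add: group_hom_def group_hom_axioms_def)
  interpret g: group_hom G Q g
    using assms by (simp add: group_hom_def group_hom_axioms_def)
  show ?thesis
    using u
  proof (induction rule: generate.induct)
    case (inv s)
    then show ?case using S eq by (metis f.hom_inv g.hom_inv subsetD)
  next
    case (eng a b)
    then have "a \<in> carrier G" "b \<in> carrier G"
      using f.G.generate_in_carrier[OF S] by auto
    then show ?case using eng by simp
  qed (simp_all add: eq)
qed

lemma finitely_presentedE:
  assumes K: "group K" and fp: "finitely_presented K"
  obtains n :: nat and R \<pi> where "finite R" "R \<subseteq> carrier (free_group {..<n})"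
    "\<pi> \<in> epi (free_group {..<n}) K"
    "kernel (free_group {..<n}) K \<pi> = normal_closure (free_group {..<n}) R"
proof -
  obtain n :: nat and R where R: "finite R" "R \<subseteq> carrier (free_group {..<n})"
    and iso: "K \<cong> free_group {..<n} Mod normal_closure (free_group {..<n}) R"
    using fp by (auto simp: finitely_presented_def)
  define F where "F = free_group {..<n}"
  define C where "C = normal_closure F R"
  interpret F: group F
    unfolding F_def by (rule group_free_group)
  interpret C: normal C F
    unfolding C_def F_def using R group_free_group by (intro normal_normal_closure) auto
  have Mod: "group (F Mod C)"
    by (rule C.factorgroup_is_group)
  obtain \<theta> where \<theta>: "\<theta> \<in> iso (F Mod C) K"
    using group.iso_sym[OF K iso] by (auto simp: is_iso_def F_def C_def)
  interpret \<theta>: group_hom "F Mod C" K \<theta>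
    using K Mod \<theta> by (simp add: group_hom_def group_hom_axioms_def iso_def)
  let ?\<pi> = "\<lambda>w. \<theta> (C #>\<^bsub>F\<^esub> w)"
  have "?\<pi> \<in> hom F K"
    using hom_compose[OF C.r_coset_hom_Mod \<theta>.homh] by (simp add: comp_def)
  moreover have "?\<pi> ` carrier F = carrier K"
  proof -
    have "\<theta> ` carrier (F Mod C) = carrier K"
      using \<theta> by (auto simp: iso_def bij_betw_def)
    then show ?thesis
      by (auto simp: FactGroup_def RCOSETS_def)
  qed
  moreover have "kernel F K ?\<pi> = C"
  proof -
    have "w \<in> C" if w: "w \<in> carrier F" "?\<pi> w = \<one>\<^bsub>K\<^esub>" for w
    proof -
      have "C #>\<^bsub>F\<^esub> w \<in> carrier (F Mod C)"
        using w by (auto simp: FactGroup_def RCOSETS_def)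
      moreover have "inj_on \<theta> (carrier (F Mod C))"
        using \<theta> by (auto simp: iso_def bij_betw_def)
      ultimately have "C #>\<^bsub>F\<^esub> w = \<one>\<^bsub>F Mod C\<^esub>"
        using w \<theta>.hom_one by (metis inj_onD group.is_monoid[OF Mod] monoid.one_closed)
      then show ?thesis
        using F.rcos_self[OF w(1) C.subgroup_axioms] by (simp add: FactGroup_def)
    qed
    moreover have "?\<pi> w = \<one>\<^bsub>K\<^esub>" if "w \<in> C" for w
      using C.rcos_const[OF F.group_axioms that] \<theta>.hom_one by (simp add: FactGroup_def)
    ultimately show ?thesis
      using C.subset by (auto simp: kernel_def)
  qed
  ultimately show ?thesis
    using that[of R n ?\<pi>] R by (simp add: epi_def F_def C_def)
qed

section \<open>Approximate homomorphisms from finitely presented groups\<close>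

text \<open>Maps that become multiplicative on each single pair of elements along a filter need not be
  homomorphisms at any stage. On a finitely presented group, finitely many pairs suffice: evaluate
  words on the images of the generators; along the filter, every fixed word gets the expected
  value, so the finitely many relators are eventually killed and the evaluation descends to a
  homomorphism. It agrees with the given map on any prescribed finite set.\<close>

lemma eventually_hom_of_finitely_presented:
  assumes K: "group K" and Q: "group Q" and fp: "finitely_presented K"
    and closed: "\<And>e u. u \<in> carrier K \<Longrightarrow> \<rho> e u \<in> carrier Q"
    and mult: "\<And>u v. u \<in> carrier K \<Longrightarrow> v \<in> carrier K \<Longrightarrow>
      eventually (\<lambda>e. \<rho> e (u \<otimes>\<^bsub>K\<^esub> v) = \<rho> e u \<otimes>\<^bsub>Q\<^esub> \<rho> e v) \<F>"
    and A: "finite A" "A \<subseteq> carrier K"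
  shows "eventually (\<lambda>e. \<exists>\<rho>' \<in> hom K Q. \<forall>a \<in> A. \<rho>' a = \<rho> e a) \<F>"
proof -
  interpret K: group K by fact
  interpret Q: group Q by fact
  obtain n :: nat and R \<pi> where R: "finite R" "R \<subseteq> carrier (free_group {..<n})"
    and \<pi>: "\<pi> \<in> epi (free_group {..<n}) K"
    and ker: "kernel (free_group {..<n}) K \<pi> = normal_closure (free_group {..<n}) R"
    by (rule finitely_presentedE[OF K fp])
  define F where "F = free_group {..<n}"
  interpret F: group F
    unfolding F_def by (rule group_free_group)
  interpret \<pi>: group_hom F K \<pi>
    using \<pi> by unfold_locales (simp add: epi_def F_def)
  have surj: "\<pi> ` carrier F = carrier K"
    using \<pi> by (simp add: epi_def F_def)
  define \<psi> where "\<psi> e = free_lift Q (\<lambda>x. \<rho> e (\<pi> (free_gen x)))" for e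
  have gen: "free_gen x \<in> carrier F" if "x < n" for x
    using that by (simp add: F_def)
  have \<psi>_hom: "\<psi> e \<in> hom F Q" for e
    unfolding \<psi>_def F_def using gen closed \<pi>.hom_closed
    by (intro free_lift_hom[OF Q]) (auto simp: F_def)
  interpret \<psi>: group_hom F Q "\<psi> e" for e
    using \<psi>_hom by unfold_locales
  have \<psi>_gen: "\<psi> e (free_gen x) = \<rho> e (\<pi> (free_gen x))" if "x < n" for e x
    unfolding \<psi>_def using that closed gen by (intro free_lift_gen[OF Q]) auto
  have \<rho>_one: "eventually (\<lambda>e. \<rho> e \<one>\<^bsub>K\<^esub> = \<one>\<^bsub>Q\<^esub>) \<F>"
    using mult[OF K.one_closed K.one_closed]
    by eventually_elim (use closed[OF K.one_closed] in simp)
  have \<rho>_inv: "eventually (\<lambda>e. \<rho> e (inv\<^bsub>K\<^esub> u) = inv\<^bsub>Q\<^esub> \<rho> e u) \<F>" if u: "u \<in> carrier K" for u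
    using mult[OF K.inv_closed[OF u] u] \<rho>_one
    by eventually_elim (use closed[OF u] closed[OF K.inv_closed[OF u]] u Q.inv_equality in simp)
  have \<psi>_eq: "eventually (\<lambda>e. \<psi> e w = \<rho> e (\<pi> w)) \<F>" if "w \<in> carrier F" for w
    using that unfolding F_def
  proof (induction w rule: free_group_induct)
    case one
    have "\<psi> e [] = \<one>\<^bsub>Q\<^esub>" "\<pi> [] = \<one>\<^bsub>K\<^esub>" for e
      using \<psi>.hom_one[of e] \<pi>.hom_one by (simp_all add: F_def)
    with \<rho>_one show ?case by (auto elim: eventually_mono)
  next
    case (gen x w)
    then have x: "free_gen x \<in> carrier F" "x < n" and w: "w \<in> carrier F"
      by (simp_all add: F_def)
    show ?case
      using gen.IH mult[OF \<pi>.hom_closed[OF x(1)] \<pi>.hom_closed[OF w]]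
      by eventually_elim (simp add: x w \<psi>_gen flip: F_def)
  next
    case (inv x w)
    then have x: "free_gen x \<in> carrier F" "x < n" and w: "w \<in> carrier F"
      by (simp_all add: F_def)
    show ?case
      using inv.IH mult[OF K.inv_closed[OF \<pi>.hom_closed[OF x(1)]] \<pi>.hom_closed[OF w]]
        \<rho>_inv[OF \<pi>.hom_closed[OF x(1)]]
      by eventually_elim (simp add: x w \<psi>_gen flip: F_def)
  qed
  have "\<exists>w. w \<in> carrier F \<and> \<pi> w = a" if "a \<in> A" for a
  proof -
    have "a \<in> \<pi> ` carrier F"
      using that A surj by blast
    then show ?thesis by blast
  qed
  then obtain wd where wd: "wd a \<in> carrier F" "\<pi> (wd a) = a" if "a \<in> A" for a
    by metis
  have "eventually (\<lambda>e. \<forall>r \<in> R. \<psi> e r = \<one>\<^bsub>Q\<^esub>) \<F>"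
  proof (intro eventually_ball_finite R(1) ballI)
    fix r assume r: "r \<in> R"
    then have \<pi>r: "\<pi> r = \<one>\<^bsub>K\<^esub>"
      using ker by (auto simp: kernel_def normal_closure_def)
    have rF: "r \<in> carrier F"
      using r R(2) by (auto simp: F_def)
    show "eventually (\<lambda>e. \<psi> e r = \<one>\<^bsub>Q\<^esub>) \<F>"
      using \<rho>_one \<psi>_eq[OF rF] by eventually_elim (simp add: \<pi>r)
  qed
  moreover have "eventually (\<lambda>e. \<forall>a \<in> A. \<psi> e (wd a) = \<rho> e a) \<F>"
  proof (intro eventually_ball_finite A(1) ballI)
    fix a assume "a \<in> A"
    from wd[OF this] \<psi>_eq[of "wd a"] show "eventually (\<lambda>e. \<psi> e (wd a) = \<rho> e a) \<F>"
      by simp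
  qed
  ultimately show ?thesis
  proof eventually_elim
    case (elim e)
    \<comment> \<open>The relators die under the corrected map, so it descends to the presented group.\<close>
    have ker_le: "kernel F K \<pi> \<subseteq> kernel F Q (\<psi> e)"
    proof -
      have "R \<subseteq> kernel F Q (\<psi> e)"
        using elim(1) R(2) by (auto simp: kernel_def F_def)
      then show ?thesis
        using \<psi>.normal_kernel[of e] by (auto simp: ker normal_closure_def F_def)
    qed
    have eq: "\<psi> e w = \<psi> e w'" if "w \<in> carrier F" "w' \<in> carrier F" "\<pi> w = \<pi> w'" for w w'
    proof -
      have "w \<otimes>\<^bsub>F\<^esub> inv\<^bsub>F\<^esub> w' \<in> kernel F K \<pi>"
        using that by (simp add: kernel_def)
      then have "\<psi> e w \<otimes>\<^bsub>Q\<^esub> inv\<^bsub>Q\<^esub> \<psi> e w' = \<one>\<^bsub>Q\<^esub>"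
        using subsetD[OF ker_le] that by (fastforce simp: kernel_def)
      then show ?thesis
        using that Q.inv_solve_right'[of "\<one>\<^bsub>Q\<^esub>" "\<psi> e w" "\<psi> e w'"] by simp
    qed
    define \<rho>' where "\<rho>' u = \<psi> e (inv_into (carrier F) \<pi> u)" for u
    have pre: "inv_into (carrier F) \<pi> u \<in> carrier F" "\<pi> (inv_into (carrier F) \<pi> u) = u"
      if "u \<in> carrier K" for u
      using that surj by (auto intro: inv_into_into f_inv_into_f)
    have \<rho>'_\<pi>: "\<rho>' (\<pi> w) = \<psi> e w" if "w \<in> carrier F" for w
      unfolding \<rho>'_def using that pre by (intro eq) auto
    have "\<rho>' \<in> hom K Q"
    proof (rule homI)
      fix u v assume u: "u \<in> carrier K" and v: "v \<in> carrier K"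
      show "\<rho>' (u \<otimes>\<^bsub>K\<^esub> v) = \<rho>' u \<otimes>\<^bsub>Q\<^esub> \<rho>' v"
        using \<rho>'_\<pi>[of "inv_into (carrier F) \<pi> u \<otimes>\<^bsub>F\<^esub> inv_into (carrier F) \<pi> v"] pre[OF u] pre[OF v]
        by (simp add: \<rho>'_def)
    qed (simp add: \<rho>'_def pre)
    moreover have "\<rho>' a = \<rho> e a" if "a \<in> A" for a
      using \<rho>'_\<pi>[of "wd a"] wd[OF that] elim(2) that by simp
    ultimately show ?case by blast
  qed
qed

section \<open>Groups over a free group with infinitely generated kernel\<close>

text \<open>Translations act on two copies of the group, so that a permutation can interchange the
  copies over a subset without moving anything inside a copy. Outside the carrier they are
  the identity, which makes them bijections of the whole type.\<close>

definition left_translation :: "('a, 'm) monoid_scheme \<Rightarrow> 'a \<Rightarrow> 'a \<times> bool \<Rightarrow> 'a \<times> bool" where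
  "left_translation K a = map_prod (\<lambda>g. if g \<in> carrier K then a \<otimes>\<^bsub>K\<^esub> g else g) id"

definition flip_on :: "'a set \<Rightarrow> 'a \<times> bool \<Rightarrow> 'a \<times> bool" where
  "flip_on P z = (fst z, if fst z \<in> P then \<not> snd z else snd z)"

lemma Bij_UNIV: "f \<in> carrier (BijGroup UNIV) \<longleftrightarrow> bij f"
  by (simp add: BijGroup_def Bij_def)

lemma mult_BijGroup_UNIV:
  "bij f \<Longrightarrow> bij g \<Longrightarrow> f \<otimes>\<^bsub>BijGroup UNIV\<^esub> g = f \<circ> g"
  by (simp add: BijGroup_def Bij_def compose_def comp_def restrict_UNIV)

lemma (in group) left_translation_mult:
  assumes "a \<in> carrier G" "b \<in> carrier G"
  shows "left_translation G (a \<otimes> b) = left_translation G a \<circ> left_translation G b"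
  using assms by (auto simp: left_translation_def fun_eq_iff m_assoc)

lemma (in group) left_translation_one: "left_translation G \<one> = id"
  by (auto simp: left_translation_def fun_eq_iff)

lemma (in group) bij_left_translation:
  assumes "a \<in> carrier G"
  shows "bij (left_translation G a)"
  using left_translation_mult[of a "inv a"] left_translation_mult[of "inv a" a] assms
  by (intro o_bij[of "left_translation G (inv a)"]) (simp_all add: left_translation_one)

lemma (in group) left_translation_hom: "left_translation G \<in> hom G (BijGroup UNIV)"
  by (auto intro!: homI simp: Bij_UNIV bij_left_translation mult_BijGroup_UNIV left_translation_mult)

lemma bij_flip_on: "bij (flip_on P)"
  by (rule o_bij[of "flip_on P"]) (auto simp: flip_on_def fun_eq_iff)

text \<open>Flipping over a subgroup \<open>P\<close> detects \<open>P\<close>: translation by \<open>a \<in> P\<close> preserves both \<open>P\<close> and its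
  complement, whereas translation by \<open>a \<notin> P\<close> moves the identity from the flipped part to the
  part that stays. With a single copy and a permutation of cosets in place of the flip, index two
  could be an exception.\<close>

lemma (in group) flip_on_commute_iff:
  assumes P: "subgroup P G" and a: "a \<in> carrier G"
  shows "flip_on P \<circ> left_translation G a = left_translation G a \<circ> flip_on P \<longleftrightarrow> a \<in> P"
proof
  assume "flip_on P \<circ> left_translation G a = left_translation G a \<circ> flip_on P"
  then have "(flip_on P \<circ> left_translation G a) (\<one>, True) = (left_translation G a \<circ> flip_on P) (\<one>, True)"
    by simp
  then show "a \<in> P"
    using a subgroup.one_closed[OF P] by (auto simp: flip_on_def left_translation_def split: if_splits)
next
  assume "a \<in> P"
  have "a \<otimes> g \<in> P \<longleftrightarrow> g \<in> P" if "g \<in> carrier G" for g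
  proof
    assume "a \<otimes> g \<in> P"
    then have "inv a \<otimes> (a \<otimes> g) \<in> P"
      using \<open>a \<in> P\<close> P by (meson subgroup.m_closed subgroup.m_inv_closed)
    then show "g \<in> P"
      using a that by (simp add: m_assoc[symmetric])
  qed (use \<open>a \<in> P\<close> P in \<open>auto intro: subgroup.m_closed\<close>)
  then show "flip_on P \<circ> left_translation G a = left_translation G a \<circ> flip_on P"
    using subgroup.subset[OF P] by (auto simp: flip_on_def left_translation_def fun_eq_iff)
qed

lemma hom_free_group_mono:
  "f \<in> hom (free_group X) Q \<Longrightarrow> Y \<subseteq> X \<Longrightarrow> f \<in> hom (free_group Y) Q"
  using free_group_mono[of Y X] by (auto simp: hom_def mult_free_group subset_iff)

lemma bij_comp_left_cancel: "bij a \<Longrightarrow> a \<circ> f = a \<circ> g \<Longrightarrow> f = g"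
  by (metis bij_is_inj fun.map_id fun.map_comp inj_iff)

text \<open>Let \<open>t\<close> be a lift of the free generator \<open>y\<close>. For a finite subset \<open>E\<close> of the kernel \<open>N\<close>, let \<open>t\<close>
  act as translation composed with the flip over \<open>\<langle>E\<rangle>\<close>, and let \<open>N\<close> and the lifts of the other
  generators act by translation. The relations between \<open>t\<close> and \<open>E\<close> survive, so these actions are
  multiplicative in the limit over \<open>E\<close>. If \<open>K\<close> were finitely presented, then for some \<open>E\<close> there
  would be an honest action of \<open>K\<close> with these values on \<open>t\<close> and on \<open>B\<close>, and hence with
  translations on all of \<open>N\<close>. Then the flip over \<open>\<langle>E\<rangle>\<close> commutes with translation by every element
  of \<open>N\<close>, and \<open>N = \<langle>E\<rangle>\<close> would be finitely generated.

  The hypothesis on \<open>B\<close> says that already the elements of \<open>K\<close> that avoid \<open>y\<close> provide a finitely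
  generated subgroup containing \<open>N\<close>; it is the finitely generated base of the HNN extension
  with stable letter \<open>t\<close>.\<close>

lemma not_finitely_presented_over_free:
  assumes K: "group K" and p: "p \<in> epi K (free_group X)" and y: "y \<in> X"
    and not_fg: "\<not> finitely_generated (K\<lparr>carrier := kernel K (free_group X) p\<rparr>)"
    and B: "finite B" "B \<subseteq> carrier K" "kernel K (free_group X) p \<subseteq> generate K B"
    and pB: "\<And>b. b \<in> B \<Longrightarrow> p b \<in> carrier (free_group (X - {y}))"
  shows "\<not> finitely_presented K"
proof
  assume fp: "finitely_presented K"
  interpret K: group K by fact
  define F where "F = free_group X"
  interpret F: group F
    unfolding F_def by (rule group_free_group)
  interpret p: group_hom K F p
    using p by unfold_locales (simp add: epi_def F_def)
  define N where "N = kernel K F p"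
  have N_iff: "u \<in> N \<longleftrightarrow> u \<in> carrier K \<and> p u = \<one>\<^bsub>F\<^esub>" for u
    by (simp add: N_def kernel_def)
  interpret N: normal N K
    unfolding N_def by (rule p.normal_kernel)
  define Q where "Q = BijGroup (UNIV :: ('a \<times> bool) set)"
  interpret Q: group Q
    unfolding Q_def by (rule group_BijGroup)
  have Q_carrier: "f \<in> carrier Q \<longleftrightarrow> bij f" for f
    by (simp add: Q_def Bij_UNIV)
  have Q_mult: "f \<otimes>\<^bsub>Q\<^esub> g = f \<circ> g" if "bij f" "bij g" for f g
    using that by (simp add: Q_def mult_BijGroup_UNIV)
  let ?L = "left_translation K"
  interpret L: group_hom K Q ?L
    unfolding Q_def using K.left_translation_hom group_BijGroup
    by (intro group_hom.intro K group_hom_axioms.intro)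
  note L.hom_mult [simp del] L.hom_inv [simp del]
  have gen: "free_gen x \<in> carrier F" if "x \<in> X" for x
    using that by (simp add: F_def)

  \<comment> \<open>Since \<open>X\<close> is a free basis, \<open>p\<close> splits.\<close>
  have "\<exists>u. u \<in> carrier K \<and> p u = free_gen x" if "x \<in> X" for x
  proof -
    have "free_gen x \<in> p ` carrier K"
      using gen[OF that] p by (simp add: epi_def F_def)
    then show ?thesis by (metis imageE)
  qed
  then obtain t where t: "t x \<in> carrier K" "p (t x) = free_gen x" if "x \<in> X" for x
    by metis
  define s where "s = free_lift K t"
  have s_hom: "s \<in> hom F K"
    unfolding s_def F_def using t by (intro free_lift_hom[OF K]) auto
  interpret s: group_hom F K s
    using s_hom by unfold_locales
  have s_gen: "s (free_gen x) = t x" if "x \<in> X" for x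
    unfolding s_def using t[OF that] by (intro free_lift_gen[OF K]) auto
  have ps: "p (s w) = w" if "w \<in> carrier F" for w
  proof -
    have "(p \<circ> s) w = id w"
    proof (rule hom_free_group_unique[OF group_free_group, where f = "p \<circ> s" and X = X])
      show "p \<circ> s \<in> hom (free_group X) (free_group X)"
        using hom_compose[OF s_hom p.homh] by (simp add: F_def)
      show "id \<in> hom (free_group X) (free_group X)"
        by (auto simp: hom_def)
    qed (use that t s_gen in \<open>auto simp: F_def\<close>)
    then show ?thesis by simp
  qed

  define \<tau> where "\<tau> E x = (if x = y then ?L (t x) \<circ> flip_on (generate K E) else ?L (t x))" for E x
  have \<tau>_bij: "bij (\<tau> E x)" if "x \<in> X" for E x
    using K.bij_left_translation[OF t(1)[OF that]] bij_flip_on by (auto simp: \<tau>_def intro: bij_comp)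
  have \<tau>_closed: "\<tau> E x \<in> carrier Q" if "x \<in> X" for E x
    using \<tau>_bij[OF that] by (simp add: Q_carrier)
  \<comment> \<open>The perturbed action of the free group, through the section \<open>s\<close>.\<close>
  define g where "g E = free_lift Q (\<tau> E)" for E
  have g_hom': "g E \<in> hom (free_group Y) Q" if "Y \<subseteq> X" for E Y
    unfolding g_def using \<tau>_closed that
    by (intro free_lift_hom) (auto simp: Q.group_axioms)
  interpret g: group_hom F Q "g E" for E
    using g_hom'[of X E] by unfold_locales (simp add: F_def)
  have g_gen: "g E (free_gen x) = \<tau> E x" if "x \<in> X" for E x
    unfolding g_def using \<tau>_closed[OF that] by (intro free_lift_gen) (auto simp: Q.group_axioms)

  let ?\<F> = "finite_subsets_at_top N"
  have \<tau>_conj: "eventually (\<lambda>E. \<tau> E x \<otimes>\<^bsub>Q\<^esub> ?L n = ?L (t x \<otimes>\<^bsub>K\<^esub> n \<otimes>\<^bsub>K\<^esub> inv\<^bsub>K\<^esub> t x) \<otimes>\<^bsub>Q\<^esub> \<tau> E x) ?\<F>"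
    if x: "x \<in> X" and n: "n \<in> N" for x n
    unfolding eventually_finite_subsets_at_top
  proof (intro exI[of _ "{n}"] conjI allI impI)
    fix E assume E: "finite E \<and> {n} \<subseteq> E \<and> E \<subseteq> N"
    have nK: "n \<in> carrier K" and tK: "t x \<in> carrier K"
      using n t(1)[OF x] by auto
    have sub: "subgroup (generate K E) K"
      using E N.subset by (intro K.generate_is_subgroup) auto
    have "n \<in> generate K E"
      using E by (auto intro: generate.incl)
    then have comm: "flip_on (generate K E) \<circ> ?L n = ?L n \<circ> flip_on (generate K E)"
      using K.flip_on_commute_iff[OF sub nK] by simp
    have L: "?L (t x \<otimes>\<^bsub>K\<^esub> n \<otimes>\<^bsub>K\<^esub> inv\<^bsub>K\<^esub> t x) \<circ> ?L (t x) = ?L (t x) \<circ> ?L n"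
      using nK tK by (simp add: K.left_translation_mult[symmetric] K.m_assoc)
    have bij: "bij (?L n)" "bij (?L (t x \<otimes>\<^bsub>K\<^esub> n \<otimes>\<^bsub>K\<^esub> inv\<^bsub>K\<^esub> t x))"
      using nK tK by (auto intro: K.bij_left_translation)
    show "\<tau> E x \<otimes>\<^bsub>Q\<^esub> ?L n = ?L (t x \<otimes>\<^bsub>K\<^esub> n \<otimes>\<^bsub>K\<^esub> inv\<^bsub>K\<^esub> t x) \<otimes>\<^bsub>Q\<^esub> \<tau> E x"
      using comm L bij \<tau>_bij[OF x]
      by (simp only: Q_mult) (auto simp: \<tau>_def fun_eq_iff simp del: split_paired_All)
  qed (use n in auto)

  have g_conj: "eventually (\<lambda>E. g E w \<otimes>\<^bsub>Q\<^esub> ?L n = ?L (s w \<otimes>\<^bsub>K\<^esub> n \<otimes>\<^bsub>K\<^esub> inv\<^bsub>K\<^esub> s w) \<otimes>\<^bsub>Q\<^esub> g E w) ?\<F>"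
    if "w \<in> carrier F" "n \<in> N" for w n
    using that unfolding F_def
  proof (induction w arbitrary: n rule: free_group_induct)
    case one
    then show ?case
      using g.hom_one s.hom_one by (simp add: F_def)
  next
    case (gen x w)
    then have x: "free_gen x \<in> carrier F" "x \<in> X" and w: "w \<in> carrier F"
      by (simp_all add: F_def)
    let ?n = "s w \<otimes>\<^bsub>K\<^esub> n \<otimes>\<^bsub>K\<^esub> inv\<^bsub>K\<^esub> s w"
    have n: "?n \<in> N"
      using gen.prems w by (intro N.inv_op_closed2) auto
    show ?case
      using gen.IH[OF gen.prems] \<tau>_conj[OF x(2) n]
    proof eventually_elim
      case (elim E)
      have closed: "\<tau> E x \<in> carrier Q" "g E w \<in> carrier Q" "n \<in> carrier K" "s w \<in> carrier K" "t x \<in> carrier K"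
        using \<tau>_closed[OF x(2)] w gen.prems t x by auto
      have "g E (free_gen x \<otimes>\<^bsub>F\<^esub> w) \<otimes>\<^bsub>Q\<^esub> ?L n = \<tau> E x \<otimes>\<^bsub>Q\<^esub> (g E w \<otimes>\<^bsub>Q\<^esub> ?L n)"
        using x w closed by (simp add: g_gen Q.m_assoc)
      also have "\<dots> = (\<tau> E x \<otimes>\<^bsub>Q\<^esub> ?L ?n) \<otimes>\<^bsub>Q\<^esub> g E w"
        using elim(1) closed by (simp add: Q.m_assoc)
      also have "\<dots> = ?L (t x \<otimes>\<^bsub>K\<^esub> ?n \<otimes>\<^bsub>K\<^esub> inv\<^bsub>K\<^esub> t x) \<otimes>\<^bsub>Q\<^esub> g E (free_gen x \<otimes>\<^bsub>F\<^esub> w)"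
        using elim(2) x w closed by (simp add: g_gen Q.m_assoc)
      also have "t x \<otimes>\<^bsub>K\<^esub> ?n \<otimes>\<^bsub>K\<^esub> inv\<^bsub>K\<^esub> t x = s (free_gen x \<otimes>\<^bsub>F\<^esub> w) \<otimes>\<^bsub>K\<^esub> n \<otimes>\<^bsub>K\<^esub> inv\<^bsub>K\<^esub> s (free_gen x \<otimes>\<^bsub>F\<^esub> w)"
        using x w closed by (simp add: s_gen K.m_assoc K.inv_mult_group)
      finally show ?case by (simp only: F_def)
    qed
  next
    case (inv x w)
    then have x: "free_gen x \<in> carrier F" "x \<in> X" and w: "w \<in> carrier F"
      by (simp_all add: F_def)
    let ?n = "s w \<otimes>\<^bsub>K\<^esub> n \<otimes>\<^bsub>K\<^esub> inv\<^bsub>K\<^esub> s w"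
    let ?m = "inv\<^bsub>K\<^esub> t x \<otimes>\<^bsub>K\<^esub> ?n \<otimes>\<^bsub>K\<^esub> t x"
    have n: "?n \<in> N"
      using inv.prems w by (intro N.inv_op_closed2) auto
    have m: "?m \<in> N"
      using n t(1)[OF x(2)] by (intro N.inv_op_closed1) auto
    show ?case
      using inv.IH[OF inv.prems] \<tau>_conj[OF x(2) m]
    proof eventually_elim
      case (elim E)
      have closed: "\<tau> E x \<in> carrier Q" "g E w \<in> carrier Q" "n \<in> carrier K" "s w \<in> carrier K" "t x \<in> carrier K"
        "?m \<in> carrier K" "?n \<in> carrier K"
        using \<tau>_closed[OF x(2)] w inv.prems t x m n by auto
      have "t x \<otimes>\<^bsub>K\<^esub> ?m \<otimes>\<^bsub>K\<^esub> inv\<^bsub>K\<^esub> t x = ?n"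
        using closed(3-5) by (simp add: K.m_assoc K.mult_inv_cancel)
      with elim(2) have "\<tau> E x \<otimes>\<^bsub>Q\<^esub> ?L ?m = ?L ?n \<otimes>\<^bsub>Q\<^esub> \<tau> E x"
        by simp
      then have swap: "inv\<^bsub>Q\<^esub> \<tau> E x \<otimes>\<^bsub>Q\<^esub> ?L ?n = ?L ?m \<otimes>\<^bsub>Q\<^esub> inv\<^bsub>Q\<^esub> \<tau> E x"
        using closed(1,6,7) L.hom_closed by (intro Q.inv_conjugation_swap) auto
      have "g E (inv\<^bsub>F\<^esub> free_gen x \<otimes>\<^bsub>F\<^esub> w) \<otimes>\<^bsub>Q\<^esub> ?L n = inv\<^bsub>Q\<^esub> \<tau> E x \<otimes>\<^bsub>Q\<^esub> (g E w \<otimes>\<^bsub>Q\<^esub> ?L n)"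
        using x w closed by (simp add: g_gen Q.m_assoc)
      also have "\<dots> = (inv\<^bsub>Q\<^esub> \<tau> E x \<otimes>\<^bsub>Q\<^esub> ?L ?n) \<otimes>\<^bsub>Q\<^esub> g E w"
        using elim(1) closed by (simp add: Q.m_assoc)
      also have "\<dots> = ?L ?m \<otimes>\<^bsub>Q\<^esub> g E (inv\<^bsub>F\<^esub> free_gen x \<otimes>\<^bsub>F\<^esub> w)"
        using swap x w closed by (simp add: g_gen Q.m_assoc)
      also have "?m = s (inv\<^bsub>F\<^esub> free_gen x \<otimes>\<^bsub>F\<^esub> w) \<otimes>\<^bsub>K\<^esub> n \<otimes>\<^bsub>K\<^esub> inv\<^bsub>K\<^esub> s (inv\<^bsub>F\<^esub> free_gen x \<otimes>\<^bsub>F\<^esub> w)"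
        using x w closed by (simp add: s_gen K.m_assoc K.inv_mult_group)
      finally show ?case by (simp only: F_def)
    qed
  qed

  \<comment> \<open>Every \<open>u\<close> is an element of \<open>N\<close> times an element of the section; the first factor acts by
    translation, the second through \<open>g E\<close>.\<close>
  define \<rho> where "\<rho> E u = ?L (u \<otimes>\<^bsub>K\<^esub> inv\<^bsub>K\<^esub> s (p u)) \<otimes>\<^bsub>Q\<^esub> g E (p u)" for E u
  have \<rho>_closed: "\<rho> E u \<in> carrier Q" if "u \<in> carrier K" for E u
    unfolding \<rho>_def using that by simp
  have \<rho>_mult: "eventually (\<lambda>E. \<rho> E (u \<otimes>\<^bsub>K\<^esub> v) = \<rho> E u \<otimes>\<^bsub>Q\<^esub> \<rho> E v) ?\<F>"
    if u: "u \<in> carrier K" and v: "v \<in> carrier K" for u v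
  proof -
    define n where "n = u \<otimes>\<^bsub>K\<^esub> inv\<^bsub>K\<^esub> s (p u)"
    define m where "m = v \<otimes>\<^bsub>K\<^esub> inv\<^bsub>K\<^esub> s (p v)"
    have nm: "n \<in> carrier K" "m \<in> N" "m \<in> carrier K"
      unfolding N_iff using u v by (simp_all add: n_def m_def ps)
    show ?thesis
      using g_conj[OF p.hom_closed[OF u] nm(2)]
    proof eventually_elim
      case (elim E)
      let ?m = "s (p u) \<otimes>\<^bsub>K\<^esub> m \<otimes>\<^bsub>K\<^esub> inv\<^bsub>K\<^esub> s (p u)"
      have m: "?m \<in> carrier K"
        using u nm by simp
      have "u \<otimes>\<^bsub>K\<^esub> v \<otimes>\<^bsub>K\<^esub> inv\<^bsub>K\<^esub> s (p (u \<otimes>\<^bsub>K\<^esub> v)) = n \<otimes>\<^bsub>K\<^esub> ?m"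
        using u v by (simp add: n_def m_def K.m_assoc K.inv_mult_group K.mult_inv_cancel)
      then have "\<rho> E (u \<otimes>\<^bsub>K\<^esub> v) = (?L n \<otimes>\<^bsub>Q\<^esub> ?L ?m) \<otimes>\<^bsub>Q\<^esub> (g E (p u) \<otimes>\<^bsub>Q\<^esub> g E (p v))"
        unfolding \<rho>_def by (simp only: L.hom_mult nm(1) m p.hom_mult u v g.hom_mult p.hom_closed)
      also have "\<dots> = ?L n \<otimes>\<^bsub>Q\<^esub> (?L ?m \<otimes>\<^bsub>Q\<^esub> g E (p u)) \<otimes>\<^bsub>Q\<^esub> g E (p v)"
        using u v nm(1) m by (simp add: Q.m_assoc)
      also have "\<dots> = (?L n \<otimes>\<^bsub>Q\<^esub> g E (p u)) \<otimes>\<^bsub>Q\<^esub> (?L m \<otimes>\<^bsub>Q\<^esub> g E (p v))"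
        unfolding elim[symmetric] using u v nm(1,3) by (simp only: Q.m_assoc L.hom_closed g.hom_closed p.hom_closed Q.m_closed)
      finally show ?case
        unfolding \<rho>_def[of E u] \<rho>_def[of E v] n_def[symmetric] m_def[symmetric] .
    qed
  qed

  \<comment> \<open>Elements that avoid \<open>y\<close> do not see the perturbation, for any \<open>E\<close>.\<close>
  have \<rho>_L: "\<rho> E u = ?L u" if u: "u \<in> carrier K" and pu: "p u \<in> carrier (free_group (X - {y}))" for E u
  proof -
    have "g E (p u) = (?L \<circ> s) (p u)"
    proof (rule hom_free_group_unique[OF Q.group_axioms g_hom' _ _ pu])
      have "?L \<circ> s \<in> hom F Q"
        by (rule hom_compose[OF s_hom L.homh])
      then show "?L \<circ> s \<in> hom (free_group (X - {y})) Q"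
        unfolding F_def by (rule hom_free_group_mono) auto
    next
      fix x assume "x \<in> X - {y}"
      then show "g E (free_gen x) = (?L \<circ> s) (free_gen x)"
        by (simp add: g_gen s_gen \<tau>_def)
    qed auto
    then have "\<rho> E u = ?L (u \<otimes>\<^bsub>K\<^esub> inv\<^bsub>K\<^esub> s (p u) \<otimes>\<^bsub>K\<^esub> s (p u))"
      using u L.hom_mult[of "u \<otimes>\<^bsub>K\<^esub> inv\<^bsub>K\<^esub> s (p u)" "s (p u)"] by (simp add: \<rho>_def)
    then show ?thesis
      using u by (simp add: K.m_assoc)
  qed

  have "eventually (\<lambda>E. \<exists>\<rho>' \<in> hom K Q. \<forall>a \<in> insert (t y) B. \<rho>' a = \<rho> E a) ?\<F>"
    using B t(1)[OF y] by (intro eventually_hom_of_finitely_presented[OF K Q.group_axioms fp \<rho>_closed \<rho>_mult]) auto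
  moreover have "eventually (\<lambda>E. finite E \<and> E \<subseteq> N) ?\<F>"
    by (rule eventually_finite_subsets_at_top_weakI) simp
  ultimately have "\<exists>E. (\<exists>\<rho>' \<in> hom K Q. \<forall>a \<in> insert (t y) B. \<rho>' a = \<rho> E a) \<and> finite E \<and> E \<subseteq> N"
    by (rule eventually_happens'[OF finite_subsets_at_top_neq_bot eventually_conj])
  then
  obtain E0 where E0: "finite E0" "E0 \<subseteq> N"
    and ex: "\<exists>\<rho>' \<in> hom K Q. \<forall>a \<in> insert (t y) B. \<rho>' a = \<rho> E0 a"
    by (elim exE conjE) (rule that)
  from ex obtain \<rho>' where \<rho>': "\<rho>' \<in> hom K Q"
    "\<And>a. a \<in> insert (t y) B \<Longrightarrow> \<rho>' a = \<rho> E0 a"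
    by (elim bexE) (rule that, assumption, rule bspec)
  interpret \<rho>': group_hom K Q \<rho>'
    using \<rho>'(1) by unfold_locales
  let ?P = "generate K E0"
  have P: "subgroup ?P K"
    using E0(2) N.subset by (intro K.generate_is_subgroup) auto
  have \<rho>'_L: "\<rho>' n = ?L n" if "n \<in> N" for n
  proof (rule hom_eq_on_generate[OF K Q.group_axioms B(2) \<rho>'(1) L.homh])
    show "\<rho>' b = ?L b" if "b \<in> B" for b
      using \<rho>'(2)[of b] \<rho>_L[OF _ pB[OF that]] that B(2) by auto
    show "n \<in> generate K B"
      using that B(3) by (auto simp: N_def F_def)
  qed
  have tK: "t y \<in> carrier K"
    using t(1)[OF y] .
  have \<rho>'_t: "\<rho>' (t y) = ?L (t y) \<circ> flip_on ?P"
    using \<rho>'(2)[of "t y"] tK t(2)[OF y] y \<tau>_bij[OF y]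
    by (simp add: \<rho>_def s_gen g_gen \<tau>_def Q_carrier)
  have "n \<in> ?P" if n: "n \<in> N" for n
  proof -
    have nK: "n \<in> carrier K"
      using n by simp
    let ?m = "t y \<otimes>\<^bsub>K\<^esub> n \<otimes>\<^bsub>K\<^esub> inv\<^bsub>K\<^esub> t y"
    have m: "?m \<in> N"
      using n tK by (intro N.inv_op_closed2)
    have bij: "bij (?L (t y))" "bij (?L n)" "bij (?L ?m)"
      using nK tK by (auto intro: K.bij_left_translation)
    have mK: "?m \<in> carrier K"
      using nK tK by simp
    have bij_tf: "bij (?L (t y) \<circ> flip_on ?P)"
      by (rule bij_comp[OF bij_flip_on bij(1)])
    have tn: "?m \<otimes>\<^bsub>K\<^esub> t y = t y \<otimes>\<^bsub>K\<^esub> n"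
      using nK tK by (simp add: K.m_assoc)
    have "\<rho>' (t y) \<otimes>\<^bsub>Q\<^esub> \<rho>' n = \<rho>' ?m \<otimes>\<^bsub>Q\<^esub> \<rho>' (t y)"
      by (simp only: \<rho>'.hom_mult[OF tK nK, symmetric] \<rho>'.hom_mult[OF mK tK, symmetric] tn)
    then have "?L (t y) \<circ> flip_on ?P \<circ> ?L n = ?L ?m \<circ> (?L (t y) \<circ> flip_on ?P)"
      unfolding \<rho>'_t \<rho>'_L[OF n] \<rho>'_L[OF m] Q_mult[OF bij_tf bij(2)] Q_mult[OF bij(3) bij_tf] .
    also have "\<dots> = (?L ?m \<circ> ?L (t y)) \<circ> flip_on ?P"
      by (simp only: comp_assoc)
    also have "?L ?m \<circ> ?L (t y) = ?L (t y) \<circ> ?L n"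
      using K.left_translation_mult[OF mK tK] K.left_translation_mult[OF tK nK] unfolding tn
      by (rule trans[OF sym])
    finally have "?L (t y) \<circ> (flip_on ?P \<circ> ?L n) = ?L (t y) \<circ> (?L n \<circ> flip_on ?P)"
      by (simp only: comp_assoc)
    then have "flip_on ?P \<circ> ?L n = ?L n \<circ> flip_on ?P"
      by (rule bij_comp_left_cancel[OF bij(1)])
    then show ?thesis
      using K.flip_on_commute_iff[OF P nK] by simp
  qed
  then have "generate K E0 = N"
    using K.generate_subgroup_incl[OF E0(2) N.subgroup_axioms] by blast
  then have "finitely_generated (K\<lparr>carrier := N\<rparr>)"
    using finitely_generated_subgroup_iff[OF K N.subgroup_axioms] E0 by blast
  with not_fg show False
    by (simp add: N_def F_def)
qed

section \<open>A finitely generated kernel\<close>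

context group
begin

definition conjugation :: "'a \<Rightarrow> 'a \<Rightarrow> 'a" where
  "conjugation g a = g \<otimes> a \<otimes> inv g"

lemma conjugation_closed [simp]: "g \<in> carrier G \<Longrightarrow> a \<in> carrier G \<Longrightarrow> conjugation g a \<in> carrier G"
  by (simp add: conjugation_def)

lemma conjugation_mult:
  "g \<in> carrier G \<Longrightarrow> h \<in> carrier G \<Longrightarrow> a \<in> carrier G \<Longrightarrow>
    conjugation (g \<otimes> h) a = conjugation g (conjugation h a)"
  by (simp add: conjugation_def inv_mult_group m_assoc)

lemma conjugation_inv_cancel:
  "g \<in> carrier G \<Longrightarrow> a \<in> carrier G \<Longrightarrow> conjugation g (conjugation (inv g) a) = a"
  "g \<in> carrier G \<Longrightarrow> a \<in> carrier G \<Longrightarrow> conjugation (inv g) (conjugation g a) = a"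
  by (simp_all add: conjugation_def m_assoc mult_inv_cancel)

lemma conjugation_hom: "g \<in> carrier G \<Longrightarrow> conjugation g \<in> hom G G"
  by (rule homI) (simp_all add: conjugation_def m_assoc mult_inv_cancel)

lemma conjugation_mem: "subgroup K G \<Longrightarrow> g \<in> K \<Longrightarrow> a \<in> K \<Longrightarrow> conjugation g a \<in> K"
  unfolding conjugation_def by (meson subgroup.m_closed subgroup.m_inv_closed)

lemma conjugation_generate_subset:
  assumes "g \<in> carrier G" "S \<subseteq> carrier G" "subgroup K G" "\<And>s. s \<in> S \<Longrightarrow> conjugation g s \<in> K"
    and "u \<in> generate G S"
  shows "conjugation g u \<in> K"
proof -
  interpret c: group_hom G G "conjugation g"
    using conjugation_hom[OF assms(1)] by unfold_locales
  have "conjugation g u \<in> generate G (conjugation g ` S)"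
    using c.generate_img[OF assms(2)] assms(5) by blast
  also have "\<dots> \<subseteq> K"
    using assms by (intro generate_subgroup_incl) auto
  finally show ?thesis .
qed

text \<open>The subgroups generated by the conjugates of \<open>A\<close> by \<open>h\<^sup>l\<close> with \<open>\<bar>l\<bar> \<le> q\<close> form a filtration. When
  \<open>h\<close> and \<open>A\<close> generate a group and \<open>\<chi>\<close> is a character with \<open>\<chi> h = 1\<close> that vanishes on \<open>A\<close>, the
  filtration exhausts the kernel of \<open>\<chi>\<close>, and each stage is finitely generated if \<open>A\<close> is finite.\<close>

definition conjugates_upto :: "'a \<Rightarrow> 'a set \<Rightarrow> nat \<Rightarrow> 'a set" where
  "conjugates_upto h A q = (\<lambda>(l :: int, a). conjugation (h [^] l) a) ` ({- int q..int q} \<times> A)"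

lemma conjugates_uptoI:
  "\<bar>l\<bar> \<le> int q \<Longrightarrow> a \<in> A \<Longrightarrow> conjugation (h [^] (l :: int)) a \<in> conjugates_upto h A q"
  unfolding conjugates_upto_def by (rule image_eqI[of _ _ "(l, a)"]) auto

abbreviation window :: "'a \<Rightarrow> 'a set \<Rightarrow> nat \<Rightarrow> 'a set" where
  "window h A q \<equiv> generate G (conjugates_upto h A q)"

lemma finite_conjugates_upto: "finite A \<Longrightarrow> finite (conjugates_upto h A q)"
  by (simp add: conjugates_upto_def)

lemma conjugates_upto_closed:
  "h \<in> carrier G \<Longrightarrow> A \<subseteq> carrier G \<Longrightarrow> conjugates_upto h A q \<subseteq> carrier G"
  by (auto simp: conjugates_upto_def)

lemma subgroup_window:
  "h \<in> carrier G \<Longrightarrow> A \<subseteq> carrier G \<Longrightarrow> subgroup (window h A q) G"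
  by (intro generate_is_subgroup conjugates_upto_closed)

lemma window_mono: "q \<le> q' \<Longrightarrow> window h A q \<subseteq> window h A q'"
  unfolding conjugates_upto_def by (intro mono_generate image_mono) auto

lemma conjugation_window:
  assumes h: "h \<in> carrier G" and A: "A \<subseteq> carrier G" and u: "u \<in> window h A q"
    and q': "int q + \<bar>m\<bar> \<le> int q'"
  shows "conjugation (h [^] (m :: int)) u \<in> window h A q'"
proof (rule conjugation_generate_subset[OF _ conjugates_upto_closed[OF h A] subgroup_window[OF h A] _ u])
  fix s assume "s \<in> conjugates_upto h A q"
  then obtain l :: int and a where s: "s = conjugation (h [^] l) a" "\<bar>l\<bar> \<le> int q" "a \<in> A"
    by (auto simp: conjugates_upto_def)
  have "conjugation (h [^] m) s = conjugation (h [^] (m + l)) a"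
    using h A s by (subst int_pow_mult) (auto simp: conjugation_mult)
  moreover have "\<bar>m + l\<bar> \<le> int q'"
    using s q' by linarith
  ultimately show "conjugation (h [^] m) s \<in> window h A q'"
    using s by (auto intro: generate.incl conjugates_uptoI)
qed (use h in simp)

text \<open>The set of products \<open>v h\<^sup>j\<close> with \<open>v\<close> in some window is closed under products and inverses,
  because conjugation by a power of \<open>h\<close> maps each window into a larger one; it contains \<open>S\<close> by the
  choice of \<open>A\<close>. The exponent \<open>j\<close> can only be the value of \<open>\<chi>\<close>.\<close>

lemma mem_union_windows:
  assumes h: "h \<in> carrier G" and S: "S \<subseteq> carrier G"
    and \<chi>: "\<chi> \<in> hom G integer_group" and \<chi>h: "\<chi> h = 1"
    and A: "A = (\<lambda>s. s \<otimes> h [^] (- \<chi> s)) ` S"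
    and u: "u \<in> generate G S"
  shows "\<exists>q. u \<otimes> h [^] (- \<chi> u) \<in> window h A q"
proof -
  interpret \<chi>: group_hom G integer_group \<chi>
    using \<chi> group_axioms group_integer_group by (simp add: group_hom_def group_hom_axioms_def)
  have AG: "A \<subseteq> carrier G"
    using h S by (auto simp: A)
  have W: "subgroup (window h A q) G" for q
    by (rule subgroup_window[OF h AG])
  have base: "\<exists>q. s \<otimes> h [^] (- \<chi> s) \<in> window h A q" if "s \<in> S" for s
  proof -
    have "s \<otimes> h [^] (- \<chi> s) = conjugation (h [^] (0::int)) (s \<otimes> h [^] (- \<chi> s))"
      using that S h by (simp add: conjugation_def subset_iff)
    then have "s \<otimes> h [^] (- \<chi> s) \<in> conjugates_upto h A 0"
      using conjugates_uptoI[of 0 0 "s \<otimes> h [^] (- \<chi> s)" A h] that by (simp add: A)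
    then show ?thesis
      by (blast intro: generate.incl)
  qed
  have inv_step: "\<exists>q. inv v \<otimes> h [^] (- \<chi> (inv v)) \<in> window h A q"
    if v: "v \<in> carrier G" and q: "v \<otimes> h [^] (- \<chi> v) \<in> window h A q" for v q
  proof -
    have "inv v \<otimes> h [^] (- \<chi> (inv v)) = conjugation (h [^] (- \<chi> v)) (inv (v \<otimes> h [^] (- \<chi> v)))"
      using v h by (simp add: conjugation_def inv_mult_group int_pow_neg m_assoc mult_inv_cancel)
    also have "\<dots> \<in> window h A (q + nat \<bar>\<chi> v\<bar>)"
      using q W by (intro conjugation_window[OF h AG]) (auto intro: subgroup.m_inv_closed)
    finally show ?thesis by blast
  qed
  show ?thesis
    using u
  proof (induction rule: generate.induct)
    case one
    show ?case
      using subgroup.one_closed[OF W] by auto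
  next
    case (incl s)
    then show ?case by (rule base)
  next
    case (inv s)
    then show ?case
      using base inv_step S by blast
  next
    case (eng v w)
    then obtain q q' where q: "v \<otimes> h [^] (- \<chi> v) \<in> window h A q"
      and q': "w \<otimes> h [^] (- \<chi> w) \<in> window h A q'"
      by blast
    have vw: "v \<in> carrier G" "w \<in> carrier G"
      using eng.hyps generate_in_carrier[OF S] by auto
    let ?r = "max q (q' + nat \<bar>\<chi> v\<bar>)"
    have "v \<otimes> w \<otimes> h [^] (- \<chi> (v \<otimes> w)) = (v \<otimes> h [^] (- \<chi> v)) \<otimes> conjugation (h [^] \<chi> v) (w \<otimes> h [^] (- \<chi> w))"
    proof -
      have "h [^] (- \<chi> (v \<otimes> w)) = h [^] (- \<chi> w) \<otimes> h [^] (- \<chi> v)"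
        using int_pow_mult[OF h, of "- \<chi> w" "- \<chi> v"] vw by (simp add: algebra_simps)
      then show ?thesis
        using vw h by (simp add: conjugation_def int_pow_neg m_assoc mult_inv_cancel)
    qed
    also have "\<dots> \<in> window h A ?r"
    proof (rule subgroup.m_closed[OF W])
      show "v \<otimes> h [^] (- \<chi> v) \<in> window h A ?r"
        using q window_mono[of q ?r] by auto
      show "conjugation (h [^] \<chi> v) (w \<otimes> h [^] (- \<chi> w)) \<in> window h A ?r"
        by (rule conjugation_window[OF h AG q']) simp
    qed
    finally show ?case by blast
  qed
qed

text \<open>With \<open>b = h\<^sup>-\<^sup>1 x h x\<^sup>-\<^sup>1\<close>, conjugation by \<open>x\<close> sends \<open>h\<close> to \<open>h b\<close>, so it sends \<open>h\<^sup>l\<close> to \<open>u h\<^sup>l\<close>, where \<open>u\<close> is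
  a product of at most \<open>\<bar>l\<bar>\<close> conjugates of \<open>b\<close> or its inverse by powers of \<open>h\<close> with exponents up
  to \<open>\<bar>l\<bar>\<close>. The constant \<open>c\<close> only has to accommodate \<open>b\<close> and the conjugates of the finitely many
  elements of \<open>A\<close>; it does not depend on \<open>l\<close>.\<close>

lemma conjugation_shifts_windows_boundedly:
  assumes h: "h \<in> carrier G" and A: "A \<subseteq> carrier G" "finite A" and x: "x \<in> carrier G"
    and xA: "\<And>a. a \<in> A \<Longrightarrow> \<exists>q. conjugation x a \<in> window h A q"
    and xh: "\<exists>q. inv h \<otimes> conjugation x h \<in> window h A q"
  shows "\<exists>c. \<forall>(l :: int) a. a \<in> A \<longrightarrow>
    x \<otimes> h [^] l \<otimes> inv x \<otimes> h [^] (- l) \<in> window h A (nat \<bar>l\<bar> + c) \<and>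
    conjugation x (conjugation (h [^] l) a) \<in> window h A (nat \<bar>l\<bar> + c)"
proof -
  define b where "b = inv h \<otimes> conjugation x h"
  have W: "subgroup (window h A q) G" for q
    by (rule subgroup_window[OF h A(1)])
  obtain qa where qa: "conjugation x a \<in> window h A (qa a)" if "a \<in> A" for a
    using xA by metis
  obtain qb where qb: "b \<in> window h A qb"
    using xh by (auto simp: b_def)
  define c where "c = Max (insert qb (qa ` A))"
  have "qa a \<le> c" if "a \<in> A" for a
    using that A(2) by (simp add: c_def)
  then have ca: "conjugation x a \<in> window h A q" if "a \<in> A" "q \<ge> c" for a q
    using that qa window_mono[of "qa a" q] by fastforce
  have "qb \<le> c"
    using A(2) by (simp add: c_def)
  then have cb: "b \<in> window h A q" if "q \<ge> c" for q
    using that qb window_mono[of qb q] by fastforce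
  have bG: "b \<in> carrier G"
    using h x by (simp add: b_def)
  have xh_eq: "x \<otimes> h \<otimes> inv x = h \<otimes> b"
    using h x by (simp add: b_def conjugation_def mult_inv_cancel m_assoc)
  define u where "u l = x \<otimes> h [^] (l :: int) \<otimes> inv x \<otimes> h [^] (- l)" for l
  have uG: "u l \<in> carrier G" for l
    using x h by (simp add: u_def)
  have u_pos: "u (int n) \<in> window h A (n + c)" for n
  proof (induction n)
    case 0
    then show ?case
      using x subgroup.one_closed[OF W] by (simp add: u_def)
  next
    case (Suc n)
    have "h [^] int (Suc n) = h \<otimes> h [^] int n"
      using h int_pow_mult[of h 1 "int n"] by simp
    moreover have "h [^] (- int (Suc n)) = h [^] (- int n) \<otimes> inv h"
      using h int_pow_mult[of h "- int n" "- 1"] by (simp add: int_pow_neg algebra_simps)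
    ultimately have "u (int (Suc n)) = (x \<otimes> h \<otimes> inv x) \<otimes> u (int n) \<otimes> inv h"
      using x h by (simp add: u_def m_assoc mult_inv_cancel del: of_nat_Suc)
    also have "\<dots> = conjugation (h [^] (1 :: int)) (b \<otimes> u (int n))"
      unfolding xh_eq using x h bG uG by (simp add: conjugation_def m_assoc)
    also have "\<dots> \<in> window h A (Suc n + c)"
      using Suc cb[of "n + c"] by (intro conjugation_window[OF h A(1)] subgroup.m_closed[OF W]) auto
    finally show ?case .
  qed
  have u_neg: "u (- int n) \<in> window h A (n + c)" for n
  proof (induction n)
    case 0
    then show ?case
      using x subgroup.one_closed[OF W] by (simp add: u_def)
  next
    case (Suc n)
    have "h [^] (- int (Suc n)) = inv h \<otimes> h [^] (- int n)"
      using h int_pow_mult[of h "- 1" "- int n"] by (simp add: int_pow_neg algebra_simps)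
    moreover have "h [^] int (Suc n) = h [^] int n \<otimes> h"
      using h int_pow_mult[of h "int n" 1] by (simp add: algebra_simps)
    ultimately have "u (- int (Suc n)) = inv (x \<otimes> h \<otimes> inv x) \<otimes> u (- int n) \<otimes> h"
      using x h by (simp add: u_def m_assoc mult_inv_cancel inv_mult_group del: of_nat_Suc)
    also have "\<dots> = inv b \<otimes> conjugation (h [^] (- 1 :: int)) (u (- int n))"
      unfolding xh_eq using x h bG uG
      by (simp add: conjugation_def m_assoc inv_mult_group int_pow_neg)
    also have "\<dots> \<in> window h A (Suc n + c)"
      using Suc cb[of "Suc n + c"]
      by (intro conjugation_window[OF h A(1)] subgroup.m_closed[OF W] subgroup.m_inv_closed[OF W]) auto
    finally show ?case .
  qed
  have u: "u l \<in> window h A (nat \<bar>l\<bar> + c)" for l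
    using u_pos[of "nat \<bar>l\<bar>"] u_neg[of "nat \<bar>l\<bar>"] by (cases "l \<ge> 0") auto
  have "conjugation x (conjugation (h [^] l) a) \<in> window h A (nat \<bar>l\<bar> + c)" if "a \<in> A" for l :: int and a
  proof -
    have aG: "a \<in> carrier G"
      using that A by blast
    have "conjugation x (conjugation (h [^] l) a) = conjugation (u l) (conjugation (h [^] l) (conjugation x a))"
      using x h aG
      by (simp add: u_def conjugation_def m_assoc mult_inv_cancel inv_mult_group int_pow_neg)
    also have "\<dots> \<in> window h A (nat \<bar>l\<bar> + c)"
      using ca[OF that order.refl] u
      by (intro conjugation_mem[OF W u] conjugation_window[OF h A(1), of _ c]) auto
    finally show ?thesis .
  qed
  then show ?thesis
    using u unfolding u_def by blast
qed

end

text \<open>If conjugation by \<open>x\<close> and by its inverse enlarges windows by at most \<open>c\<close>, then \<open>M = c + 1\<close>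
  works. The conjugates by \<open>h\<^sup>q\<^sup>+\<^sup>1\<close> may lie outside the window of size \<open>q\<close>; conjugation by
  \<open>x h\<^sup>-\<^sup>M\<close> first moves them to exponent \<open>q - c\<close> and then leads at most \<open>c\<close> further out, so
  it lands in the window of size \<open>q\<close>. Starting from one sufficiently large window, the element
  \<open>x h\<^sup>-\<^sup>M\<close> therefore generates all windows.\<close>

lemma (in group) kernel_in_finitely_generated_extension:
  assumes H: "normal H G" and S: "finite S" "S \<subseteq> carrier G" "generate G S = H"
    and \<chi>: "\<chi> \<in> hom G integer_group" and h: "h \<in> H" "\<chi> h = 1" and x: "x \<in> carrier G"
  obtains M :: int and B where "finite B" "B \<subseteq> {g \<in> H. \<chi> g = 0}"
    "{g \<in> H. \<chi> g = 0} \<subseteq> generate G (insert (x \<otimes> h [^] (- M)) B)"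
proof -
  interpret H: normal H G by fact
  interpret \<chi>: group_hom G integer_group \<chi>
    using \<chi> group_axioms group_integer_group by (simp add: group_hom_def group_hom_axioms_def)
  have \<chi>_inv: "\<chi> (inv g) = - \<chi> g" if "g \<in> carrier G" for g
    using that by simp
  have \<chi>_pow: "\<chi> (h [^] (l :: int)) = l" for l
    using \<chi>.hom_int_pow[of h l] h by simp
  define N where "N = {g \<in> H. \<chi> g = 0}"
  have hG: "h \<in> carrier G"
    using h by simp
  define A where "A = (\<lambda>s. s \<otimes> h [^] (- \<chi> s)) ` S"
  have SH: "S \<subseteq> H"
    using S(3) by (auto intro: generate.incl)
  have AN: "A \<subseteq> N"
    using SH h H.subset by (auto simp: A_def N_def \<chi>_pow intro!: H.m_closed subgroup_int_pow_closed[OF H.subgroup_axioms])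
  have A: "A \<subseteq> carrier G" "finite A"
    using AN S(1) by (auto simp: N_def A_def)
  have W: "subgroup (window h A q) G" for q
    by (rule subgroup_window[OF hG A(1)])
  have N_window: "\<exists>q. u \<in> window h A q" if "u \<in> N" for u
    using mem_union_windows[OF hG S(2) \<chi> h(2) A_def, of u] that S(3) by (auto simp: N_def)
  have conj_N: "conjugation y a \<in> N" if "y \<in> carrier G" "a \<in> N" for y a
    using that H.inv_op_closed2 by (auto simp: N_def conjugation_def \<chi>_inv)
  have comm_N: "inv h \<otimes> conjugation y h \<in> N" if "y \<in> carrier G" for y
    using that h H.inv_op_closed2 by (auto simp: N_def conjugation_def \<chi>_inv)
  have "\<exists>c. \<forall>(l :: int) a. a \<in> A \<longrightarrow>
      y \<otimes> h [^] l \<otimes> inv y \<otimes> h [^] (- l) \<in> window h A (nat \<bar>l\<bar> + c) \<and>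
      conjugation y (conjugation (h [^] l) a) \<in> window h A (nat \<bar>l\<bar> + c)"
    if y: "y \<in> carrier G" for y
    by (rule conjugation_shifts_windows_boundedly[OF hG A y N_window[OF conj_N[OF y subsetD[OF AN]]]
          N_window[OF comm_N[OF y]]])
  from this[OF x] this[OF inv_closed[OF x]] obtain c1 c2
    where c1: "\<And>(l :: int) a. a \<in> A \<Longrightarrow>
        x \<otimes> h [^] l \<otimes> inv x \<otimes> h [^] (- l) \<in> window h A (nat \<bar>l\<bar> + c1)"
      "\<And>(l :: int) a. a \<in> A \<Longrightarrow>
        conjugation x (conjugation (h [^] l) a) \<in> window h A (nat \<bar>l\<bar> + c1)"
    and c2: "\<And>(l :: int) a. a \<in> A \<Longrightarrow>
        conjugation (inv x) (conjugation (h [^] l) a) \<in> window h A (nat \<bar>l\<bar> + c2)"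
    by (elim exE) (rule that, auto)
  show ?thesis
  proof (cases "A = {}")
    \<comment> \<open>Then all windows are trivial, and so is \<open>N\<close>.\<close>
    case True
    have "N \<subseteq> {\<one>}"
      using N_window generate_empty by (auto simp: True conjugates_upto_def)
    then show ?thesis
      using that[of "{}" 0] generate.one by (auto simp: N_def)
  next
    case False
    then obtain a0 where a0: "a0 \<in> A" by blast
    define c where "c = max c1 c2"
    have cx: "conjugation x (conjugation (h [^] l) a) \<in> window h A q"
      if "a \<in> A" "nat \<bar>l\<bar> + c \<le> q" for a q and l :: int
      using that(2) by (intro subsetD[OF window_mono c1(2)[OF that(1)]]) (auto simp: c_def that)
    have cx': "conjugation (inv x) (conjugation (h [^] l) a) \<in> window h A q"
      if "a \<in> A" "nat \<bar>l\<bar> + c \<le> q" for a q and l :: int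
      using that(2) by (intro subsetD[OF window_mono c2[OF that(1)]]) (auto simp: c_def that)
    have cu: "x \<otimes> h [^] l \<otimes> inv x \<otimes> h [^] (- l) \<in> window h A (nat \<bar>l\<bar> + c)" for l :: int
      using c1(1)[of a0 l] a0 window_mono[of "nat \<bar>l\<bar> + c1" "nat \<bar>l\<bar> + c" h A] by (auto simp: c_def)
    define M where "M = int c + 1"
    \<comment> \<open>The size \<open>M + c\<close> makes room for the commutator of \<open>x\<close> with \<open>h\<^sup>M\<close>, which relates \<open>t\<close>
      to \<open>t'\<close> below.\<close>
    define B where "B = conjugates_upto h A (2 * c + 1)"
    define t where "t = x \<otimes> h [^] (- M)"
    define T where "T = generate G (insert t B)"
    have t: "t \<in> carrier G"
      using x hG by (simp add: t_def)
    have BN: "B \<subseteq> N"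
      using conj_N AN hG by (auto simp: B_def conjugates_upto_def)
    then have B: "B \<subseteq> carrier G"
      by (auto simp: N_def)
    have T: "subgroup T G"
      unfolding T_def using t B by (intro generate_is_subgroup) auto
    have tT: "t \<in> T"
      unfolding T_def by (rule generate.incl) simp
    have base: "window h A (2 * c + 1) \<subseteq> T"
      unfolding T_def B_def by (rule mono_generate) auto
    \<comment> \<open>Conjugation by \<open>t\<close> first shifts down by \<open>M\<close> and then acts by \<open>x\<close>; the element \<open>t'\<close> acts
      by \<open>x\<close> first, and it serves the negative exponents.\<close>
    define t' where "t' = h [^] (- M) \<otimes> x"
    have t': "t' \<in> carrier G"
      using x hG by (simp add: t'_def)
    have t'T: "t' \<in> T"
    proof -
      let ?u = "x \<otimes> h [^] (- M) \<otimes> inv x \<otimes> h [^] (- (- M))"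
      have "?u \<in> T"
      proof -
        have "nat \<bar>- M\<bar> + c = 2 * c + 1"
          by (simp add: M_def)
        then show ?thesis
          using subsetD[OF base] cu[of "- M"] by metis
      qed
      moreover have "t' = inv ?u \<otimes> t"
        using x hG by (simp add: t'_def t_def inv_mult_group int_pow_neg m_assoc mult_inv_cancel)
      ultimately show ?thesis
        using tT T by (simp add: subgroup.m_closed subgroup.m_inv_closed)
    qed
    have "window h A q \<subseteq> T" for q
    proof (induction q)
      case 0
      then show ?case
        using base window_mono[of 0 "2 * c + 1"] by blast
    next
      case (Suc q)
      show ?case
      proof (cases "Suc q \<le> 2 * c + 1")
        case True
        then show ?thesis
          using base window_mono[OF True] by blast
      next
        case False
        show ?thesis
        proof (rule generate_subgroup_incl[OF _ T], rule subsetI)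
          fix v assume "v \<in> conjugates_upto h A (Suc q)"
          then obtain l :: int and a where v: "v = conjugation (h [^] l) a" and a: "a \<in> A"
            and l: "- int (Suc q) \<le> l" "l \<le> int (Suc q)"
            by (auto simp: conjugates_upto_def)
          have aG: "a \<in> carrier G" and vG: "v \<in> carrier G"
            using a A hG by (auto simp: v)
          consider "\<bar>l\<bar> \<le> int q" | "l = int (Suc q)" | "l = - int (Suc q)"
            using l by linarith
          then show "v \<in> T"
          proof cases
            case 1
            then have "v \<in> window h A q"
              using a by (auto simp: v intro: generate.incl conjugates_uptoI)
            then show ?thesis
              using Suc by blast
          next
            case 2
            have "conjugation t v = conjugation x (conjugation (h [^] (- M + l)) a)"
              using x hG aG by (simp add: t_def v conjugation_mult int_pow_mult del: add_uminus_conv_diff uminus_add_conv_diff)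
            also have "\<dots> \<in> window h A q"
              using False by (intro cx a) (auto simp: M_def 2)
            finally have "conjugation t v \<in> T"
              using Suc by blast
            then have "conjugation (inv t) (conjugation t v) \<in> T"
              by (rule conjugation_mem[OF T subgroup.m_inv_closed[OF T tT]])
            then show ?thesis
              using t vG by (simp add: conjugation_inv_cancel)
          next
            case 3
            have "conjugation (inv t') v = conjugation (inv x) (conjugation (h [^] (M + l)) a)"
              using x hG aG by (simp add: t'_def v conjugation_mult int_pow_mult inv_mult_group int_pow_neg)
            also have "\<dots> \<in> window h A q"
              using False by (intro cx' a) (auto simp: M_def 3)
            finally have "conjugation (inv t') v \<in> T"
              using Suc by blast
            then have "conjugation t' (conjugation (inv t') v) \<in> T"
              by (rule conjugation_mem[OF T t'T])
            then show ?thesis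
              using t' vG by (simp add: conjugation_inv_cancel)
          qed
        qed
      qed
    qed
    then have "N \<subseteq> T"
      using N_window by blast
    then show ?thesis
      using that[of B M] BN finite_conjugates_upto[OF A(2)] by (simp add: N_def T_def t_def B_def)
  qed
qed

section \<open>Incoherence of groups over a free group\<close>

text \<open>The generator \<open>x\<close> is used to make the kernel \<open>K\<close> finitely generated, with \<open>N\<close> inside the
  subgroup lying over \<open>\<langle>x\<rangle>\<close>; the second generator \<open>y\<close> is the stable letter that prevents \<open>K\<close> from
  being finitely presented.\<close>

theorem incoherent_if_character_kernel_not_finitely_generated:
  assumes G: "group G" and X: "finite X" "x \<in> X" "y \<in> X" "x \<noteq> y"
    and p: "p \<in> epi G (free_group X)"
    and fg: "finitely_generated (G\<lparr>carrier := kernel G (free_group X) p\<rparr>)"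
    and \<chi>: "\<chi> \<in> hom G integer_group"
    and h: "h \<in> kernel G (free_group X) p" "\<chi> h = 1"
    and not_fg: "\<not> finitely_generated
      (G\<lparr>carrier := {g \<in> kernel G (free_group X) p. \<chi> g = 0}\<rparr>)"
  shows "incoherent G"
proof -
  interpret G: group G by fact
  define F where "F = free_group X"
  interpret F: group F
    unfolding F_def by (rule group_free_group)
  interpret p: group_hom G F p
    using p by unfold_locales (simp add: epi_def F_def)
  interpret \<chi>: group_hom G integer_group \<chi>
    using \<chi> G group_integer_group by (simp add: group_hom_def group_hom_axioms_def)
  define H where "H = kernel G F p"
  have H_iff: "g \<in> H \<longleftrightarrow> g \<in> carrier G \<and> p g = []" for g
    by (simp add: H_def kernel_def F_def)
  have H: "normal H G"
    unfolding H_def by (rule p.normal_kernel)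
  have hG: "h \<in> carrier G" and ph: "p h = []"
    using h(1) by (auto simp: kernel_def)
  have \<chi>_pow: "\<chi> (h [^]\<^bsub>G\<^esub> (l :: int)) = l" for l
    using \<chi>.hom_int_pow[OF hG, of l] h(2) by simp
  have p_pow: "p (h [^]\<^bsub>G\<^esub> (l :: int)) = \<one>\<^bsub>F\<^esub>" for l
    using p.hom_int_pow[OF hG, of l] ph F.int_pow_one[of l] by (simp add: F_def del: F.int_pow_one)
  have "finitely_generated (G\<lparr>carrier := H\<rparr>)"
    using fg by (simp add: H_def F_def)
  then obtain S where S: "finite S" "S \<subseteq> H" "generate G S = H"
    using finitely_generated_subgroup_iff[OF G normal_imp_subgroup[OF H]] by blast
  have SG: "S \<subseteq> carrier G"
    using S(2) by (auto simp: H_iff)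
  have hH: "h \<in> H"
    using h(1) by (simp add: H_def F_def)
  have "\<exists>g. g \<in> carrier G \<and> p g = free_gen z \<and> \<chi> g = 0" if "z \<in> X" for z
  proof -
    have "free_gen z \<in> p ` carrier G"
      using p that by (simp add: epi_def)
    then obtain g where g: "g \<in> carrier G" "p g = free_gen z"
      by (metis imageE)
    have "free_gen z \<in> carrier F"
      using that by (simp add: F_def)
    then show ?thesis
      using g hG by (intro exI[of _ "g \<otimes>\<^bsub>G\<^esub> h [^]\<^bsub>G\<^esub> (- \<chi> g)"]) (simp add: \<chi>_pow p_pow)
  qed
  then obtain t where t: "t z \<in> carrier G" "p (t z) = free_gen z" "\<chi> (t z) = 0" if "z \<in> X" for z
    by metis
  define N where "N = {g \<in> H. \<chi> g = 0}"
  obtain M :: int and B where B: "finite B" "B \<subseteq> N"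
    and NB: "N \<subseteq> generate G (insert (t x \<otimes>\<^bsub>G\<^esub> h [^]\<^bsub>G\<^esub> (- M)) B)"
    unfolding N_def
    by (rule G.kernel_in_finitely_generated_extension[OF H S(1) SG S(3) \<chi> hH h(2) t(1)[OF X(2)]])
  define r where "r = t x \<otimes>\<^bsub>G\<^esub> h [^]\<^bsub>G\<^esub> (- M)"
  have r: "r \<in> carrier G" "p r = free_gen x" "\<chi> r = - M"
    using t[OF X(2)] hG X(2) F.r_one[of "free_gen x"] by (simp_all add: r_def \<chi>_pow p_pow F_def)

  \<comment> \<open>Adding \<open>e \<circ> p\<close> to \<open>\<chi>\<close> kills \<open>r\<close> and does not affect \<open>\<chi>\<close> on \<open>H\<close>.\<close>
  define e where "e = free_lift integer_group (\<lambda>z. if z = x then M else 0)"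
  have e_hom: "e \<in> hom F integer_group"
    unfolding e_def F_def by (rule free_lift_hom) auto
  have e_gen: "e (free_gen z) = (if z = x then M else 0)" if "z \<in> X" for z
    unfolding e_def by (subst free_lift_gen) auto
  define \<psi> where "\<psi> g = \<chi> g + e (p g)" for g
  have "\<psi> \<in> hom G integer_group"
    using hom_mult[OF e_hom] by (intro homI) (simp_all add: \<psi>_def)
  then interpret \<psi>: group_hom G integer_group \<psi>
    using G group_integer_group by (simp add: group_hom_def group_hom_axioms_def)
  interpret e: group_hom F integer_group e
    using e_hom group_integer_group by unfold_locales
  define K where "K = kernel G integer_group \<psi>"
  have K_iff: "g \<in> K \<longleftrightarrow> g \<in> carrier G \<and> \<chi> g + e (p g) = 0" for g
    by (simp add: K_def kernel_def \<psi>_def)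
  have K: "subgroup K G"
    unfolding K_def by (rule \<psi>.subgroup_kernel)
  have e_Nil: "e [] = 0"
    using e.hom_one by (simp add: F_def)
  have N_K: "g \<in> N \<longleftrightarrow> g \<in> K \<and> p g = []" for g
    by (auto simp: N_def H_iff K_iff e_Nil)

  define C where "C = insert r B \<union> t ` (X - {x})"
  have C: "C \<subseteq> K"
  proof -
    have "r \<in> K"
      using r e_gen[OF X(2)] by (simp add: K_iff)
    moreover have "t z \<in> K" if "z \<in> X - {x}" for z
      using t[of z] e_gen[of z] that by (simp add: K_iff)
    moreover have "B \<subseteq> K"
      using B(2) N_K by blast
    ultimately show ?thesis
      by (auto simp: C_def)
  qed
  have CG: "C \<subseteq> carrier G"
    using C by (auto simp: K_iff)
  have gC: "subgroup (generate G C) G"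
    by (rule G.generate_is_subgroup[OF CG])
  have gC_K: "generate G C \<subseteq> K"
    by (rule G.generate_subgroup_incl[OF C K])
  have gen_C: "\<exists>v \<in> C. p v = free_gen z" if "z \<in> X" for z
    using that r(2) t(2)[OF that] by (cases "z = x") (auto simp: C_def)
  have onto: "\<exists>v \<in> generate G C. p v = w" if "w \<in> carrier F" for w
    using that unfolding F_def
  proof (induction w rule: free_group_induct)
    case one
    show ?case
      using p.hom_one generate.one by (auto simp: F_def intro!: bexI[of _ "\<one>\<^bsub>G\<^esub>"])
  next
    case (gen z w)
    obtain u v where uv: "u \<in> C" "p u = free_gen z" "v \<in> generate G C" "p v = w"
      using gen.IH gen_C[OF gen.hyps(1)] by blast
    have "u \<in> carrier G" "v \<in> carrier G"
      using uv CG G.generate_in_carrier[OF CG] by auto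
    then have "p (u \<otimes>\<^bsub>G\<^esub> v) = free_gen z \<otimes>\<^bsub>F\<^esub> w"
      using uv by simp
    moreover have "u \<otimes>\<^bsub>G\<^esub> v \<in> generate G C"
      by (rule generate.eng[OF generate.incl[OF uv(1)] uv(3)])
    ultimately show ?case
      unfolding F_def by blast
  next
    case (inv z w)
    obtain u v where uv: "u \<in> C" "p u = free_gen z" "v \<in> generate G C" "p v = w"
      using inv.IH gen_C[OF inv.hyps(1)] by blast
    have "u \<in> carrier G" "v \<in> carrier G"
      using uv CG G.generate_in_carrier[OF CG] by auto
    then have "p (inv\<^bsub>G\<^esub> u \<otimes>\<^bsub>G\<^esub> v) = inv\<^bsub>F\<^esub> free_gen z \<otimes>\<^bsub>F\<^esub> w"
      using uv by simp
    moreover have "inv\<^bsub>G\<^esub> u \<otimes>\<^bsub>G\<^esub> v \<in> generate G C"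
      by (rule generate.eng[OF generate.inv[OF uv(1)] uv(3)])
    ultimately show ?case
      unfolding F_def by blast
  qed
  have N_C: "N \<subseteq> generate G C"
  proof -
    have "generate G (insert r B) \<subseteq> generate G C"
      by (rule G.mono_generate) (auto simp: C_def)
    with NB show ?thesis
      unfolding r_def by (rule subset_trans)
  qed
  have "K \<subseteq> generate G C"
  proof
    fix g assume g: "g \<in> K"
    then have gG: "g \<in> carrier G"
      by (simp add: K_iff)
    obtain v where v: "v \<in> generate G C" "p v = p g"
      using onto[OF p.hom_closed[OF gG]] by blast
    have vG: "v \<in> carrier G" and vK: "v \<in> K"
      using v(1) G.generate_in_carrier[OF CG] gC_K by auto
    have "g \<otimes>\<^bsub>G\<^esub> inv\<^bsub>G\<^esub> v \<in> K"
      using g vK K by (simp add: subgroup.m_closed subgroup.m_inv_closed)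
    moreover have "p (g \<otimes>\<^bsub>G\<^esub> inv\<^bsub>G\<^esub> v) = \<one>\<^bsub>F\<^esub>"
      using gG vG v(2) by simp
    ultimately have "g \<otimes>\<^bsub>G\<^esub> inv\<^bsub>G\<^esub> v \<in> N"
      unfolding N_K by (simp add: F_def)
    then have "g \<otimes>\<^bsub>G\<^esub> inv\<^bsub>G\<^esub> v \<in> generate G C"
      by (rule subsetD[OF N_C])
    then have "g \<otimes>\<^bsub>G\<^esub> inv\<^bsub>G\<^esub> v \<otimes>\<^bsub>G\<^esub> v \<in> generate G C"
      using v(1) by (rule subgroup.m_closed[OF gC])
    then show "g \<in> generate G C"
      using gG vG by (simp add: G.m_assoc)
  qed
  then have "generate G C = K"
    using gC_K by blast
  moreover have "finite C"
    using B(1) X(1) by (simp add: C_def)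
  ultimately have K_fg: "finitely_generated (G\<lparr>carrier := K\<rparr>)"
    unfolding finitely_generated_subgroup_iff[OF G K] using C by blast

  let ?K = "G\<lparr>carrier := K\<rparr>"
  have ker: "kernel ?K (free_group X) p = N"
    by (auto simp: kernel_def N_K)
  have "\<not> finitely_presented ?K"
  proof (rule not_finitely_presented_over_free[where y = y and B = "insert r B"])
    show "group ?K"
      using K by (rule subgroup.subgroup_is_group) (rule G)
    have "p ` K = carrier F"
      using onto gC_K p.hom_closed by (fastforce simp: K_iff)
    moreover have "p \<in> hom ?K F"
      using p.homh by (auto simp: hom_def K_iff)
    ultimately show "p \<in> epi ?K (free_group X)"
      by (simp add: epi_def F_def)
    show "\<not> finitely_generated (?K\<lparr>carrier := kernel ?K (free_group X) p\<rparr>)"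
      unfolding ker using not_fg by (simp add: N_def H_def F_def)
    show "insert r B \<subseteq> carrier ?K"
      using C by (auto simp: C_def)
    then show "kernel ?K (free_group X) p \<subseteq> generate ?K (insert r B)"
      using G.generate_consistent[OF _ K, of "insert r B"] NB by (simp add: ker r_def)
    show "p b \<in> carrier (free_group (X - {y}))" if "b \<in> insert r B" for b
      using that r(2) B(2) X monoid.one_closed[OF group.is_monoid[OF group_free_group[of "X - {y}"]]]
      by (auto simp: N_K)
  qed (use X B in auto)
  then show ?thesis
    using K K_fg by (auto simp: coherent_def)
qed

section \<open>Integral characters from real ones\<close>

text \<open>Any \<open>\<rat>\<close>-linear extension of \<open>r \<mapsto> 1\<close> to the \<open>\<rat>\<close>-vector space \<open>\<real>\<close>.\<close>

lemma exists_additive_real_to_rat: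
  assumes "r \<noteq> 0"
  obtains \<mu> :: "real \<Rightarrow> rat" where "\<And>x y. \<mu> (x + y) = \<mu> x + \<mu> y" "\<mu> r = 1"
proof -
  let ?s = "\<lambda>(q :: rat) (x :: real). of_rat q * x"
  have R: "vector_space ?s"
    by unfold_locales (simp_all add: algebra_simps of_rat_add of_rat_mult)
  have Q: "vector_space ((*) :: rat \<Rightarrow> rat \<Rightarrow> rat)"
    by unfold_locales (simp_all add: algebra_simps)
  interpret RQ: vector_space_pair ?s "(*) :: rat \<Rightarrow> rat \<Rightarrow> rat"
    using R Q by (simp add: vector_space_pair_def)
  have "RQ.vs1.independent {r}"
    using assms by (simp add: RQ.vs1.independent_insert RQ.vs1.independent_empty)
  then obtain \<mu> where lin: "Vector_Spaces.linear ?s (*) \<mu>" and r: "\<mu> r = 1"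
    using RQ.linear_independent_extend[of "{r}" "\<lambda>_. 1"] by auto
  interpret lin: Vector_Spaces.linear ?s "(*) :: rat \<Rightarrow> rat \<Rightarrow> rat" \<mu>
    by (rule lin)
  show ?thesis
    using that[of \<mu>] lin.add r by blast
qed

lemma common_denominator:
  assumes "finite (Q :: rat set)"
  obtains D :: int where "D > 0" "\<And>q. q \<in> Q \<Longrightarrow> of_int D * q \<in> \<int>"
proof -
  have "\<exists>D :: int. D > 0 \<and> (\<forall>q \<in> Q. of_int D * q \<in> \<int>)"
    using assms
  proof induction
    case empty
    show ?case by (intro exI[of _ 1]) simp
  next
    case (insert q Q)
    then obtain D :: int where D: "D > 0" "\<forall>q \<in> Q. of_int D * q \<in> \<int>"
      by blast
    obtain a b where q: "q = of_int a / of_int b" "b > 0"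
      by (metis quotient_of_denom_pos quotient_of_div surj_pair)
    have "of_int (D * b) * q \<in> \<int>"
      using q by simp
    moreover have "of_int (D * b) * q' \<in> \<int>" if "q' \<in> Q" for q'
    proof -
      have "of_int (D * b) * q' = of_int b * (of_int D * q')"
        by simp
      also have "\<dots> \<in> \<int>"
        by (rule Ints_mult[OF Ints_of_int bspec[OF D(2) that]])
      finally show ?thesis .
    qed
    ultimately show ?case
      using D(1) q(2) by (intro exI[of _ "D * b"]) simp
  qed
  then show ?thesis
    using that by blast
qed

lemma integer_character_image:
  assumes A: "group A" and \<chi>: "\<chi> \<in> hom A integer_group" and a: "a \<in> carrier A" "\<chi> a \<noteq> 0"
  obtains d where "d > 0" "d \<in> \<chi> ` carrier A" "\<And>u. u \<in> carrier A \<Longrightarrow> d dvd \<chi> u"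
proof -
  interpret A: group A by fact
  interpret \<chi>: group_hom A integer_group \<chi>
    using \<chi> A group_integer_group by (simp add: group_hom_def group_hom_axioms_def)
  define P where "P n \<longleftrightarrow> n > 0 \<and> int n \<in> \<chi> ` carrier A" for n
  have "\<chi> (inv\<^bsub>A\<^esub> a) \<in> \<chi> ` carrier A" "\<chi> a \<in> \<chi> ` carrier A"
    using a by blast+
  then have ex: "P (nat \<bar>\<chi> a\<bar>)"
    using a by (cases "\<chi> a > 0") (simp_all add: P_def)
  have P: "P (LEAST n. P n)"
    by (rule LeastI[of P, OF ex])
  have least: "(LEAST n. P n) \<le> n" if "P n" for n
    by (rule Least_le[of P, OF that])
  define d where "d = int (LEAST n. P n)"
  have d_pos: "d > 0"
    using P by (simp add: P_def d_def)
  obtain w where w: "w \<in> carrier A" "\<chi> w = d"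
    using P by (auto simp: P_def d_def)
  have "d dvd \<chi> u" if u: "u \<in> carrier A" for u
  proof (rule ccontr)
    assume "\<not> d dvd \<chi> u"
    then have "\<chi> u mod d \<noteq> 0"
      using dvd_eq_mod_eq_0[of d "\<chi> u"] by blast
    then have pos: "\<chi> u mod d > 0"
      using pos_mod_sign[OF d_pos, of "\<chi> u"] by linarith
    have "\<chi> (u \<otimes>\<^bsub>A\<^esub> w [^]\<^bsub>A\<^esub> (- (\<chi> u div d))) = \<chi> u mod d"
      using u w \<chi>.hom_int_pow[OF w(1), of "- (\<chi> u div d)"] by (simp add: minus_mult_div_eq_mod mult.commute)
    then have "\<chi> u mod d \<in> \<chi> ` carrier A"
      using u w by (intro rev_image_eqI[of "u \<otimes>\<^bsub>A\<^esub> w [^]\<^bsub>A\<^esub> (- (\<chi> u div d))"]) simp_all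
    then have "d \<le> int (nat (\<chi> u mod d))"
      using least[of "nat (\<chi> u mod d)"] pos by (simp add: P_def d_def)
    moreover have "\<chi> u mod d < d"
      using d_pos by simp
    ultimately show False
      using pos by simp
  qed
  then show ?thesis
    using that[of d] P w by (auto simp: P_def d_def)
qed

text \<open>The image of \<open>f\<close> is a finitely generated subgroup of \<open>\<real>\<close>. A \<open>\<rat>\<close>-linear map \<open>\<real> \<rightarrow> \<rat>\<close> sends it to
  a finitely generated subgroup of \<open>\<rat>\<close>, and clearing denominators and dividing by the positive
  generator gives \<open>\<int>\<close>. The integral character is stated as a composite \<open>c \<circ> f\<close> because any
  symmetry of \<open>f\<close> then passes to it.\<close>

lemma integer_character_of_real_character:
  assumes A: "group A" and fg: "finitely_generated A"
    and f: "\<And>u v. u \<in> carrier A \<Longrightarrow> v \<in> carrier A \<Longrightarrow> f (u \<otimes>\<^bsub>A\<^esub> v) = f u + (f v :: real)"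
    and a: "a \<in> carrier A" "f a \<noteq> 0"
  obtains c :: "real \<Rightarrow> int" where "(\<lambda>u. c (f u)) \<in> epi A integer_group"
proof -
  interpret A: group A by fact
  obtain S where S: "finite S" "S \<subseteq> carrier A" "generate A S = carrier A"
    using fg by (auto simp: finitely_generated_def)
  have f_one: "f \<one>\<^bsub>A\<^esub> = 0"
    using f[OF A.one_closed A.one_closed] by simp
  have f_inv: "f (inv\<^bsub>A\<^esub> u) = - f u" if "u \<in> carrier A" for u
    using f[OF A.inv_closed[OF that] that] f_one that by simp
  obtain \<mu> :: "real \<Rightarrow> rat" where add: "\<And>x y. \<mu> (x + y) = \<mu> x + \<mu> y" and \<mu>a: "\<mu> (f a) = 1"
    by (rule exists_additive_real_to_rat[OF a(2)]) (rule that)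
  have zero: "\<mu> 0 = 0"
    using add[of 0 0] by simp
  have minus: "\<mu> (- x) = - \<mu> x" for x
    using add[of "- x" x] zero by simp
  obtain D :: int where D: "D > 0" "\<And>q. q \<in> (\<lambda>s. \<mu> (f s)) ` S \<Longrightarrow> of_int D * q \<in> \<int>"
    by (rule common_denominator[OF finite_imageI[OF S(1), of "\<lambda>s. \<mu> (f s)"]]) (rule that)
  have int: "of_int D * \<mu> (f u) \<in> \<int>" if "u \<in> carrier A" for u
    using that unfolding S(3)[symmetric]
  proof (induction rule: generate.induct)
    case one
    show ?case by (simp add: f_one zero)
  next
    case (incl s)
    then show ?case using D(2) by blast
  next
    case (inv s)
    then have "of_int D * \<mu> (f s) \<in> \<int>"
      using D(2) by blast
    then show ?case
      using inv S(2) by (simp add: f_inv minus subset_iff)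
  next
    case (eng u v)
    then have "u \<in> carrier A" "v \<in> carrier A"
      using A.generate_in_carrier[OF S(2)] by auto
    then show ?case
      using Ints_add[OF eng.IH] by (simp add: f add distrib_left)
  qed
  define \<chi> where "\<chi> u = \<lfloor>of_int D * \<mu> (f u)\<rfloor>" for u
  have \<chi>: "of_int (\<chi> u) = of_int D * \<mu> (f u)" if "u \<in> carrier A" for u
    using int[OF that] by (simp add: \<chi>_def)
  have "\<chi> (u \<otimes>\<^bsub>A\<^esub> v) = \<chi> u + \<chi> v" if "u \<in> carrier A" "v \<in> carrier A" for u v
  proof -
    have "(of_int (\<chi> (u \<otimes>\<^bsub>A\<^esub> v)) :: rat) = of_int (\<chi> u + \<chi> v)"
      using that by (simp add: \<chi> f add distrib_left)
    then show ?thesis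
      by (simp only: of_int_eq_iff)
  qed
  then have \<chi>_hom: "\<chi> \<in> hom A integer_group"
    by (intro homI) auto
  have "\<chi> a \<noteq> 0"
    using D(1) by (simp add: \<chi>_def \<mu>a)
  then obtain d where d: "d > 0" "d \<in> \<chi> ` carrier A" "\<And>u. u \<in> carrier A \<Longrightarrow> d dvd \<chi> u"
    by (rule integer_character_image[OF A \<chi>_hom a(1)]) (rule that)
  have "(\<lambda>u. \<chi> u div d) \<in> hom A integer_group"
    using d \<chi>_hom by (intro homI) (auto simp: hom_mult div_plus_div_distrib_dvd_left)
  moreover have "(\<lambda>u. \<chi> u div d) ` carrier A = UNIV"
  proof -
    obtain w where w: "w \<in> carrier A" "\<chi> w = d"
      using d(2) by blast
    interpret \<chi>: group_hom A integer_group \<chi>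
      using \<chi>_hom A group_integer_group by (simp add: group_hom_def group_hom_axioms_def)
    have "l = \<chi> (w [^]\<^bsub>A\<^esub> l) div d" for l :: int
      using \<chi>.hom_int_pow[OF w(1), of l] w d(1) by simp
    then have "l \<in> (\<lambda>u. \<chi> u div d) ` carrier A" for l :: int
      using A.int_pow_closed[OF w(1)] by (rule image_eqI)
    then show ?thesis
      by blast
  qed
  ultimately have "(\<lambda>u. \<chi> u div d) \<in> epi A integer_group"
    by (simp add: epi_def)
  then show ?thesis
    using that[of "\<lambda>x. \<lfloor>of_int D * \<mu> x\<rfloor> div d"] by (simp add: \<chi>_def)
qed

section \<open>Excessive homology\<close>

text \<open>If every cocycle vanished on the kernel, each would factor through the free group and be
  determined by its values on \<open>k\<close> lifts of the generators; the pulled back exponent sums \<open>b i\<close>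
  would span the first cohomology, which would then have dimension at most \<open>k\<close>.\<close>

lemma excessive_homology_cocycle:
  fixes k :: nat
  assumes G: "group G" and p: "p \<in> epi G (free_group {..<k})" and exc: "excessive_homology k G"
  obtains f g where "f \<in> cocycles1 G" "g \<in> kernel G (free_group {..<k}) p" "f g \<noteq> 0"
proof (rule ccontr)
  assume "\<not> thesis"
  with that have vanish: "f g = 0"
    if "f \<in> cocycles1 G" "g \<in> kernel G (free_group {..<k}) p" for f g
    using that by blast
  interpret G: group G by fact
  define F where "F = free_group {..<k}"
  interpret F: group F
    unfolding F_def by (rule group_free_group)
  interpret p: group_hom G F p
    using p by unfold_locales (simp add: epi_def F_def)
  let ?V = "cohomology1 G"
  interpret V: vectorspace class_ring ?V
    by (rule vectorspace_cohomology1)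

  define e where "e i = free_lift integer_group (\<lambda>j :: nat. if j = i then 1 else 0)" for i
  have e_hom: "e i \<in> hom F integer_group" for i
    unfolding e_def F_def by (rule free_lift_hom) auto
  interpret e: group_hom F integer_group "e i" for i
    using e_hom group_integer_group F.group_axioms by (simp add: group_hom_def group_hom_axioms_def)
  have e_gen: "e i (free_gen j) = (if j = i then 1 else 0)" for i j
    unfolding e_def by (subst free_lift_gen) auto
  define b where "b i g = (if g \<in> carrier G then real_of_int (e i (p g)) else 0)" for i g
  have b: "b i \<in> cocycles1 G" for i
    by (simp add: cocycles1_def b_def)

  have "\<exists>g. g \<in> carrier G \<and> p g = free_gen i" if "i < k" for i
  proof -
    have "free_gen i \<in> p ` carrier G"
      using p that by (simp add: epi_def)
    then show ?thesis
      by (metis imageE)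
  qed
  then obtain t where t: "t i \<in> carrier G" "p (t i) = free_gen i" if "i < k" for i
    by metis

  have decomp: "f g = (\<Sum>i<k. f (t i) * b i g)" if f: "f \<in> cocycles1 G" for f g
  proof (cases "g \<in> carrier G")
    case False
    then show ?thesis
      using f by (simp add: cocycles1_def b_def)
  next
    case True
    have f_mult: "f (u \<otimes>\<^bsub>G\<^esub> v) = f u + f v" if "u \<in> carrier G" "v \<in> carrier G" for u v
    proof -
      have "f v - f (u \<otimes>\<^bsub>G\<^esub> v) + f u = 0"
        using f that by (simp add: cocycles1_def)
      then show ?thesis by simp
    qed
    have f_one: "f \<one>\<^bsub>G\<^esub> = 0"
      using f_mult[of "\<one>\<^bsub>G\<^esub>" "\<one>\<^bsub>G\<^esub>"] by simp
    have f_inv: "f (inv\<^bsub>G\<^esub> u) = - f u" if "u \<in> carrier G" for u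
      using f_mult[of "inv\<^bsub>G\<^esub> u" u] f_one that by simp
    have "\<exists>u \<in> carrier G. p u = w \<and> f u = (\<Sum>i<k. f (t i) * real_of_int (e i w))"
      if "w \<in> carrier F" for w
      using that unfolding F_def
    proof (induction w rule: free_group_induct)
      case one
      have "e i [] = 0" for i
        using e.hom_one[of i] by (simp add: F_def)
      then show ?case
        using p.hom_one f_one by (intro bexI[of _ "\<one>\<^bsub>G\<^esub>"]) (simp_all add: F_def)
    next
      case (gen x w)
      then obtain u where u: "u \<in> carrier G" "p u = w" "f u = (\<Sum>i<k. f (t i) * real_of_int (e i w))"
        by blast
      have x: "free_gen x \<in> carrier F" "x < k" and w: "w \<in> carrier F"
        using gen.hyps by (simp_all add: F_def)
      have "f (t x) = (\<Sum>i<k. f (t i) * real_of_int (e i (free_gen x)))"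
        using x(2) by (simp add: e_gen if_distrib[of real_of_int] if_distrib[of "\<lambda>r. _ * r"] cong: if_cong)
      then have "f (t x \<otimes>\<^bsub>G\<^esub> u) = (\<Sum>i<k. f (t i) * real_of_int (e i (free_gen x \<otimes>\<^bsub>F\<^esub> w)))"
        using u(1) u(3) t[OF x(2)] x(1) w by (simp add: f_mult distrib_left sum.distrib)
      then show ?case
        using u t[OF x(2)] unfolding F_def[symmetric] by (intro bexI[of _ "t x \<otimes>\<^bsub>G\<^esub> u"]) auto
    next
      case (inv x w)
      then obtain u where u: "u \<in> carrier G" "p u = w" "f u = (\<Sum>i<k. f (t i) * real_of_int (e i w))"
        by blast
      have x: "free_gen x \<in> carrier F" "x < k" and w: "w \<in> carrier F"
        using inv.hyps by (simp_all add: F_def)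
      have "f (t x) = (\<Sum>i<k. f (t i) * real_of_int (e i (free_gen x)))"
        using x(2) by (simp add: e_gen if_distrib[of real_of_int] if_distrib[of "\<lambda>r. _ * r"] cong: if_cong)
      then have "f (inv\<^bsub>G\<^esub> t x \<otimes>\<^bsub>G\<^esub> u) =
          (\<Sum>i<k. f (t i) * real_of_int (e i (inv\<^bsub>F\<^esub> free_gen x \<otimes>\<^bsub>F\<^esub> w)))"
        using u(1) u(3) t[OF x(2)] x(1) w
        by (simp add: f_mult f_inv right_diff_distrib sum_subtractf)
      then show ?case
        using u t[OF x(2)] unfolding F_def[symmetric]
        by (intro bexI[of _ "inv\<^bsub>G\<^esub> t x \<otimes>\<^bsub>G\<^esub> u"]) auto
    qed
    then obtain u where u: "u \<in> carrier G" "p u = p g"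
        "f u = (\<Sum>i<k. f (t i) * real_of_int (e i (p g)))"
      using p.hom_closed[OF True] by blast
    have "g \<otimes>\<^bsub>G\<^esub> inv\<^bsub>G\<^esub> u \<in> kernel G F p"
      using True u by (simp add: kernel_def)
    then have "f (g \<otimes>\<^bsub>G\<^esub> inv\<^bsub>G\<^esub> u) = 0"
      using vanish[OF f] by (simp add: F_def)
    then have "f g = f u"
      using True u(1) by (simp add: f_mult f_inv)
    then show ?thesis
      using u(3) True by (simp add: b_def)
  qed

  have class_eq: "cohomology_class1 G f = {f}" for f
    by (simp add: cohomology_class1_def coboundaries1_eq)
  have carrier: "carrier ?V = (\<lambda>f. {f}) ` cocycles1 G"
    by (simp add: cohomology1_def class_eq)
  have add: "{f} \<oplus>\<^bsub>?V\<^esub> {g} = {\<lambda>x. f x + g x}" for f g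
    by (simp add: cohomology1_def)
  have smult: "c \<odot>\<^bsub>?V\<^esub> {f} = {\<lambda>x. c * f x}" for c f
    by (simp add: cohomology1_def coboundaries1_eq)
  define S where "S = (\<lambda>i. {b i}) ` {..<k}"
  have S: "finite S" "S \<subseteq> carrier ?V" "card S \<le> k"
    using b card_image_le[of "{..<k}" "\<lambda>i. {b i}"] by (auto simp: S_def carrier)
  interpret span: submodule class_ring "V.span S" ?V
    by (rule V.span_is_submodule[OF S(2)])
  have "{f} \<in> V.span S" if f: "f \<in> cocycles1 G" for f
  proof -
    have span: "{\<lambda>g. \<Sum>i<j. f (t i) * b i g} \<in> V.span S" if "j \<le> k" for j
      using that
    proof (induction j)
      case 0
      show ?case
        using span.zero_closed by (simp add: cohomology1_def coboundaries1_eq)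
    next
      case (Suc j)
      have "{b j} \<in> V.span S"
        using V.in_own_span[OF S(2)] Suc.prems by (auto simp: S_def)
      then have "f (t j) \<odot>\<^bsub>?V\<^esub> {b j} \<in> V.span S"
        by (intro span.smult_closed) simp_all
      moreover have "{\<lambda>g. \<Sum>i<j. f (t i) * b i g} \<in> V.span S"
        using Suc by simp
      ultimately have "{\<lambda>g. \<Sum>i<j. f (t i) * b i g} \<oplus>\<^bsub>?V\<^esub> (f (t j) \<odot>\<^bsub>?V\<^esub> {b j}) \<in> V.span S"
        by (intro span.m_closed)
      then show ?case
        by (simp add: add smult)
    qed
    have "f = (\<lambda>g. \<Sum>i<k. f (t i) * b i g)"
      by (rule ext) (rule decomp[OF f])
    then show ?thesis
      using span[OF order.refl] by (rule ssubst[where P = "\<lambda>h. {h} \<in> V.span S"])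
  qed
  then have "V.span S = carrier ?V"
    using span.subset by (auto simp: carrier)
  then have "V.fin_dim" "V.dim \<le> k"
    using S V.gen_ge_dim[OF S(1,2)] by (auto simp: V.fin_dim_def)
  then show False
    using exc by (simp add: excessive_homology_def)
qed

section \<open>Semidirect products with a free group\<close>

text \<open>The first factor embeds as the kernel of the projection \<open>snd\<close>. A homomorphism \<open>f\<close> to an abelian
  group satisfies \<open>f (\<alpha> w h, []) = f (h, [])\<close>, since the two arguments are conjugate in \<open>G\<close>; so the
  integral character obtained from \<open>f\<close> extends to \<open>G\<close> by \<open>\<chi> \<circ> fst\<close>.\<close>

theorem theorem4p6:
  fixes k :: nat
    and H :: "('a, 'm) monoid_scheme"
    and \<alpha> :: "(nat \<times> bool) list \<Rightarrow> 'a \<Rightarrow> 'a"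
    and G :: "('a \<times> (nat \<times> bool) list) monoid"
  assumes "k \<ge> 2"
    and "group H"
    and "finitely_generated H"
    and "\<not> algebraically_fibers H"
    and "\<alpha> \<in> hom (free_group {..<k}) (AutoGroup H)"
    and "G = semidirect_product H (free_group {..<k}) \<alpha>"
    and "excessive_homology k G"
  shows "incoherent G"
proof -
  define F where "F = free_group {..<k}"
  have F: "group F"
    unfolding F_def by (rule group_free_group)
  interpret F: group F by fact
  interpret H: group H by fact
  have G: "group G"
    unfolding assms(6) by (rule group_semidirect_product[OF assms(2) group_free_group assms(5)])
  interpret G: group G by fact
  interpret \<alpha>: group_hom F "AutoGroup H" \<alpha>
    using assms(5) F H.AutoGroup by (simp add: group_hom_def group_hom_axioms_def F_def)
  have G_carrier: "carrier G = carrier H \<times> carrier F"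
    and G_mult: "(h, w) \<otimes>\<^bsub>G\<^esub> (h', w') = (h \<otimes>\<^bsub>H\<^esub> \<alpha> w h', w \<otimes>\<^bsub>F\<^esub> w')" for h w h' w'
    by (simp_all add: assms(6) semidirect_product_def F_def)
  have Nil: "[] \<in> carrier F" "[] = \<one>\<^bsub>F\<^esub>"
    using F.one_closed by (simp_all add: F_def)
  have Nil_Nil: "[] \<otimes>\<^bsub>F\<^esub> [] = []"
    by (simp add: F_def mult_free_group reduce_def)
  have \<alpha>_hom: "\<alpha> w \<in> hom H H" if "w \<in> carrier F" for w
    using \<alpha>.hom_closed[OF that] by (simp add: AutoGroup_def auto_def)
  have \<alpha>_closed: "\<alpha> w h \<in> carrier H" if "w \<in> carrier F" "h \<in> carrier H" for w h
    using \<alpha>_hom[OF that(1)] that(2) by (rule hom_in_carrier)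
  have \<alpha>_Nil: "\<alpha> [] h = h" if "h \<in> carrier H" for h
    using \<alpha>.hom_one that by (simp add: AutoGroup_def BijGroup_def Nil)
  have \<alpha>_one: "\<alpha> w \<one>\<^bsub>H\<^esub> = \<one>\<^bsub>H\<^esub>" if "w \<in> carrier F" for w
    using \<alpha>_hom[OF that] assms(2) assms(2) by (rule hom_one)

  have p: "snd \<in> epi G (free_group {..<k})"
  proof -
    have "snd \<in> hom G F"
      by (rule homI) (auto simp: G_carrier G_mult)
    moreover have "snd ` carrier G = carrier F"
      using H.one_closed by (force simp: G_carrier)
    ultimately show ?thesis
      by (simp add: epi_def F_def)
  qed
  have ker: "kernel G (free_group {..<k}) snd = (\<lambda>h. (h, [])) ` carrier H"
    using Nil(1) by (auto simp: kernel_def G_carrier)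

  obtain f g where f: "f \<in> cocycles1 G" and g: "g \<in> kernel G (free_group {..<k}) snd" "f g \<noteq> 0"
    by (rule excessive_homology_cocycle[OF G p assms(7)])
  obtain h0 where h0: "h0 \<in> carrier H" "f (h0, []) \<noteq> 0"
    using g by (auto simp: ker)
  have f_mult: "f (u \<otimes>\<^bsub>G\<^esub> v) = f u + f v" if "u \<in> carrier G" "v \<in> carrier G" for u v
  proof -
    have "f v - f (u \<otimes>\<^bsub>G\<^esub> v) + f u = 0"
      using f that by (simp add: cocycles1_def)
    then show ?thesis by simp
  qed
  have f_H: "f (h \<otimes>\<^bsub>H\<^esub> h', []) = f (h, []) + f (h', [])" if "h \<in> carrier H" "h' \<in> carrier H" for h h'
    using f_mult[of "(h, [])" "(h', [])"] that Nil(1)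
    by (simp add: G_carrier G_mult \<alpha>_Nil Nil_Nil)
  have f_\<alpha>: "f (\<alpha> w h, []) = f (h, [])" if w: "w \<in> carrier F" and h: "h \<in> carrier H" for w h
  proof -
    have "(\<one>\<^bsub>H\<^esub>, w) \<otimes>\<^bsub>G\<^esub> (h, []) = (\<alpha> w h, []) \<otimes>\<^bsub>G\<^esub> (\<one>\<^bsub>H\<^esub>, w)"
      using w h \<alpha>_closed[OF w h] F.l_one[OF w] F.r_one[OF w] by (simp add: G_mult \<alpha>_Nil Nil(2)[symmetric])
    then have "f (\<one>\<^bsub>H\<^esub>, w) + f (h, []) = f (\<alpha> w h, []) + f (\<one>\<^bsub>H\<^esub>, w)"
      using w h \<alpha>_closed[OF w h] Nil(1) f_mult[of "(\<one>\<^bsub>H\<^esub>, w)" "(h, [])"] f_mult[of "(\<alpha> w h, [])" "(\<one>\<^bsub>H\<^esub>, w)"]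
      by (simp add: G_carrier)
    then show ?thesis by simp
  qed

  obtain c :: "real \<Rightarrow> int" where c: "(\<lambda>h. c (f (h, []))) \<in> epi H integer_group"
    by (rule integer_character_of_real_character[OF assms(2,3) f_H h0])
  define \<chi> where "\<chi> h = c (f (h, []))" for h
  have \<chi>_epi: "\<chi> \<in> epi H integer_group"
    using c by (simp add: \<chi>_def[abs_def])
  have \<chi>_hom: "\<chi> \<in> hom H integer_group"
    using \<chi>_epi by (simp add: epi_def)
  have \<chi>_\<alpha>: "\<chi> (\<alpha> w h) = \<chi> h" if "w \<in> carrier F" "h \<in> carrier H" for w h
    using f_\<alpha>[OF that] by (simp add: \<chi>_def)
  have \<chi>_fst: "(\<lambda>u. \<chi> (fst u)) \<in> hom G integer_group"
    using hom_mult[OF \<chi>_hom] by (intro homI) (auto simp: G_carrier G_mult \<alpha>_closed \<chi>_\<alpha>)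
  have "1 \<in> \<chi> ` carrier H"
    using \<chi>_epi by (simp add: epi_def)
  then obtain h1 where h1: "h1 \<in> carrier H" "\<chi> h1 = 1"
    by (metis imageE)

  let ?N = "{u \<in> kernel G (free_group {..<k}) snd. \<chi> (fst u) = 0}"
  let ?L = "kernel H integer_group \<chi>"
  interpret p: group_hom G F snd
    using p by unfold_locales (simp add: epi_def F_def)
  interpret \<chi>: group_hom H integer_group \<chi>
    using \<chi>_hom assms(2) group_integer_group by (simp add: group_hom_def group_hom_axioms_def)
  interpret \<chi>G: group_hom G integer_group "\<lambda>u. \<chi> (fst u)"
    using \<chi>_fst G group_integer_group by (simp add: group_hom_def group_hom_axioms_def)
  have ker_sub: "subgroup (kernel G F snd) G"
    by (rule p.subgroup_kernel)

  show ?thesis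
  proof (rule incoherent_if_character_kernel_not_finitely_generated[OF G _ _ _ _ p _ \<chi>_fst])
    show "(0 :: nat) \<in> {..<k}" "1 \<in> {..<k}"
      using assms(1) by auto
    have "(\<lambda>h. (h, [])) \<in> epi H (G\<lparr>carrier := kernel G (free_group {..<k}) snd\<rparr>)"
      by (auto simp: epi_def ker hom_def G_mult \<alpha>_Nil Nil_Nil)
    moreover have "group (G\<lparr>carrier := kernel G (free_group {..<k}) snd\<rparr>)"
      using subgroup.subgroup_is_group[OF ker_sub G] by (simp add: F_def)
    ultimately show "finitely_generated (G\<lparr>carrier := kernel G (free_group {..<k}) snd\<rparr>)"
      by (intro finitely_generated_epi_image[OF assms(2) _ _ assms(3)])
    show "(h1, []) \<in> kernel G (free_group {..<k}) snd" "\<chi> (fst (h1, [] :: (nat \<times> bool) list)) = 1"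
      using h1 by (auto simp: ker)
    show "\<not> finitely_generated (G\<lparr>carrier := ?N\<rparr>)"
    proof
      assume fg: "finitely_generated (G\<lparr>carrier := ?N\<rparr>)"
      have N_eq: "?N = kernel G F snd \<inter> kernel G integer_group (\<lambda>u. \<chi> (fst u))"
        by (auto simp: kernel_def F_def)
      have "subgroup ?N G"
        unfolding N_eq by (rule G.subgroups_Inter_pair[OF ker_sub \<chi>G.subgroup_kernel])
      then have "group (G\<lparr>carrier := ?N\<rparr>)"
        using G by (rule subgroup.subgroup_is_group)
      moreover have "group (H\<lparr>carrier := ?L\<rparr>)"
        using \<chi>.subgroup_kernel assms(2) by (rule subgroup.subgroup_is_group)
      moreover have "fst \<in> epi (G\<lparr>carrier := ?N\<rparr>) (H\<lparr>carrier := ?L\<rparr>)"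
      proof -
        have N_img: "?N = (\<lambda>h. (h, [])) ` ?L"
          unfolding ker by (auto simp: kernel_def)
        have "fst \<in> hom (G\<lparr>carrier := ?N\<rparr>) (H\<lparr>carrier := ?L\<rparr>)"
          unfolding N_img by (rule homI) (auto simp: G_mult \<alpha>_Nil kernel_def)
        moreover have "fst ` ?N = ?L"
          unfolding N_img by (simp add: image_image)
        ultimately show ?thesis
          by (simp add: epi_def)
      qed
      ultimately have "finitely_generated (H\<lparr>carrier := ?L\<rparr>)"
        using fg by (rule finitely_generated_epi_image)
      then show False
        using assms(4) \<chi>_epi by (auto simp: algebraically_fibers_def)
    qed
  qed simp_all
qed

end
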